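(* Let $p\ge 2$ be prime, $g_0\ge 0$ and $t>0$ integers, and let $F_0$ be a Fuchsian group acting on the upper half plane $U$ with presentation $$F_0=\Big\langle a_1,\dots,a_{g_0},b_1,\dots,b_{g_0},x_1,\dots,x_t \ \Big|\ x_1x_2\cdots x_t\prod_{i=1}^{g_0}[a_i,b_i]=1,\ x_j^p=1\ (1\le j\le t)\Big\rangle .$$ Let $\phi:F_0\to\mathbb{Z}_p$ be a surjective homomorphism with $\phi(a_i)=\phi(b_i)=0$ for all $i$ and $\phi(x_j)=n_j\neq 0$ for all $j$. Let $F=\ker\phi$, suppose that $S=U/F$ is a compact Riemann surface of genus $g\ge 2$, and let $h$ be the conformal automorphism of $S$ of order $p$ induced by conjugation $f\mapsto x_1fx_1^{-1}$ on $F$. Put $A_i=a_i$, $B_i=b_i$ for $1\le i\le g_0$ and $X_i=x_i\,\overline{x_i}^{\,-1}$ for $3\le i\le t$, where $\overline{x_i}$ is the power of $x_1$ with $\phi(\overline{x_i})=\phi(x_i)$. Then the images in $H_1(S,\mathbb{Z})=F/[F,F]$ of the elements $$h^j(A_i),\ h^j(B_i)\quad(1\le i\le g_0,\ 0\le j\le p-1),\qquad h^j(X_i)\quad(3\le i\le t,\ 0\le j\le p-2)$$ form a homology basis for $S$ that is adapted to $h$.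
   Context: Here $h^j(f)=x_1^jfx_1^{-j}$ for $f\in F$, and $F\cong\pi_1(S)$, so $H_1(S,\mathbb{Z})$ is the abelianization of $F$. A homology basis for $S$ is a $\mathbb{Z}$-basis of $H_1(S,\mathbb{Z})$. Adapted: a homology basis for $S$ is adapted to an automorphism $h$ of prime order $p$ if for each $\gamma_0$ in the basis there is a $\gamma$ with $\gamma_0=h^k(\gamma)$ for some integer $k$, and either (1) $\gamma,h(\gamma),\dots,h^{p-1}(\gamma)$ are all in the basis, or (2) $\gamma,h(\gamma),\dots,h^{p-2}(\gamma)$ are all in the basis and $h^{p-1}(\gamma)$ is homologous to $-(\gamma+h(\gamma)+\dots+h^{p-2}(\gamma))$. *)

theory Defs
  imports
    "HOL-Analysis.Analysis"
    "HOL-Algebra.Bij"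
    "HOL-Algebra.Generated_Groups"
    "HOL-Algebra.Elementary_Groups"
    "HOL-Homology.Homology"
    "HOL-Computational_Algebra.Primes"
begin

section \<open>Fuchsian groups and their orbit surfaces\<close>

definition upper_half_plane :: "complex set" where
  "upper_half_plane = {z. Im z > 0}"

text \<open>
  The automorphism of the upper half plane given by a real matrix of determinant 1. As always for
  \<^const>\<open>BijGroup\<close>, it is extended by \<^const>\<open>undefined\<close> outside the half plane, so that equality
  of functions is equality in PSL(2,R).
\<close>
definition moebius_UHP :: "real^2^2 \<Rightarrow> complex \<Rightarrow> complex" where
  "moebius_UHP M = restrict
     (moebius (of_real (M$1$1)) (of_real (M$1$2)) (of_real (M$2$1)) (of_real (M$2$2)))
     upper_half_plane"

definition PSL2R :: "(complex \<Rightarrow> complex) monoid" where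
  "PSL2R = (BijGroup upper_half_plane)\<lparr>carrier := {moebius_UHP M |M. det M = 1}\<rparr>"

abbreviation subgroup_of_PSL2R :: "(complex \<Rightarrow> complex) set \<Rightarrow> (complex \<Rightarrow> complex) monoid" where
  "subgroup_of_PSL2R \<Gamma> \<equiv> PSL2R\<lparr>carrier := \<Gamma>\<rparr>"

text \<open>
  Since SL(2,R) is a two-sheeted covering of PSL(2,R), a subgroup of PSL(2,R) is discrete iff its
  preimage in SL(2,R) is.
\<close>
definition fuchsian_group :: "(complex \<Rightarrow> complex) set \<Rightarrow> bool" where
  "fuchsian_group \<Gamma> \<longleftrightarrow>
     subgroup \<Gamma> PSL2R \<and> discrete {M :: real^2^2. det M = 1 \<and> moebius_UHP M \<in> \<Gamma>}"

definition orbit :: "(complex \<Rightarrow> complex) set \<Rightarrow> complex \<Rightarrow> complex set" where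
  "orbit \<Gamma> z = {f z |f. f \<in> \<Gamma>}"

text \<open>The orbit space with the quotient topology; its conformal structure is the one inherited from
  the half plane.\<close>
definition orbit_surface :: "(complex \<Rightarrow> complex) set \<Rightarrow> complex set topology" where
  "orbit_surface \<Gamma> = topology (\<lambda>V. V \<subseteq> orbit \<Gamma> ` upper_half_plane \<and>
     openin (top_of_set upper_half_plane) {z \<in> upper_half_plane. orbit \<Gamma> z \<in> V})"

lemma istopology_orbit_surface:
  "istopology (\<lambda>V. V \<subseteq> orbit \<Gamma> ` upper_half_plane \<and>
     openin (top_of_set upper_half_plane) {z \<in> upper_half_plane. orbit \<Gamma> z \<in> V})"
proof -
  have int: "{z \<in> upper_half_plane. orbit \<Gamma> z \<in> V \<inter> W} =
      {z \<in> upper_half_plane. orbit \<Gamma> z \<in> V} \<inter> {z \<in> upper_half_plane. orbit \<Gamma> z \<in> W}" for V W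
    by auto
  have un: "{z \<in> upper_half_plane. orbit \<Gamma> z \<in> \<Union>\<K>} =
      \<Union>((\<lambda>V. {z \<in> upper_half_plane. orbit \<Gamma> z \<in> V}) ` \<K>)" for \<K>
    by auto
  show ?thesis
    unfolding istopology_def int un by (auto intro!: openin_Int openin_Union)
qed

lemma quotient_map_orbit_surface:
  "quotient_map (top_of_set upper_half_plane) (orbit_surface \<Gamma>) (orbit \<Gamma>)"
proof -
  have op: "openin (orbit_surface \<Gamma>) V \<longleftrightarrow> V \<subseteq> orbit \<Gamma> ` upper_half_plane \<and>
     openin (top_of_set upper_half_plane) {z \<in> upper_half_plane. orbit \<Gamma> z \<in> V}" for V
    unfolding orbit_surface_def by (subst topology_inverse'[OF istopology_orbit_surface]) simp
  have "{z \<in> upper_half_plane. orbit \<Gamma> z \<in> orbit \<Gamma> ` upper_half_plane} = upper_half_plane"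
    by auto
  then have "openin (orbit_surface \<Gamma>) (orbit \<Gamma> ` upper_half_plane)"
    unfolding op by simp
  then have "topspace (orbit_surface \<Gamma>) = orbit \<Gamma> ` upper_half_plane"
    by (metis op openin_subset openin_topspace subset_antisym)
  then show ?thesis
    unfolding quotient_map_def op by auto
qed

text \<open>The genus of a compact connected orientable surface, read off from its singular homology.\<close>
definition has_genus :: "'a topology \<Rightarrow> nat \<Rightarrow> bool" where
  "has_genus S g \<longleftrightarrow> homology_group 1 S \<cong> free_Abelian_group {..<2 * g}"


section \<open>Group presentations\<close>

text \<open>A word is a list of letters \<open>(s, True)\<close>, standing for $s$, and \<open>(s, False)\<close>, standing for
  $s^{-1}$.\<close>
type_synonym 's word = "('s \<times> bool) list"

definition words :: "'s set \<Rightarrow> 's word set" where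
  "words Y = lists (Y \<times> UNIV)"

inductive word_eq :: "'s set \<Rightarrow> 's word set \<Rightarrow> 's word \<Rightarrow> 's word \<Rightarrow> bool" for Y R where
  refl: "u \<in> words Y \<Longrightarrow> word_eq Y R u u"
| sym: "word_eq Y R u w \<Longrightarrow> word_eq Y R w u"
| trans: "word_eq Y R u v \<Longrightarrow> word_eq Y R v w \<Longrightarrow> word_eq Y R u w"
| cancel: "u \<in> words Y \<Longrightarrow> w \<in> words Y \<Longrightarrow> s \<in> Y \<Longrightarrow>
    word_eq Y R (u @ [(s, e), (s, \<not> e)] @ w) (u @ w)"
| relator: "u \<in> words Y \<Longrightarrow> w \<in> words Y \<Longrightarrow> r \<in> R \<Longrightarrow> word_eq Y R (u @ r @ w) (u @ w)"

fun word_val :: "('a, 'b) monoid_scheme \<Rightarrow> ('s \<Rightarrow> 'a) \<Rightarrow> 's word \<Rightarrow> 'a" where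
  "word_val G v [] = \<one>\<^bsub>G\<^esub>"
| "word_val G v ((s, e) # w) = (if e then v s else inv\<^bsub>G\<^esub> (v s)) \<otimes>\<^bsub>G\<^esub> word_val G v w"

text \<open>\<open>G\<close> has the presentation with generating symbols \<open>Y\<close>, interpreted by \<open>v\<close>, and relators \<open>R\<close>:
  evaluation identifies \<open>G\<close> with the words modulo free cancellation and insertion or deletion of
  relators.\<close>
definition presentation ::
  "('a, 'b) monoid_scheme \<Rightarrow> 's set \<Rightarrow> 's word set \<Rightarrow> ('s \<Rightarrow> 'a) \<Rightarrow> bool" where
  "presentation G Y R v \<longleftrightarrow>
     group G \<and> v ` Y \<subseteq> carrier G \<and> R \<subseteq> words Y \<and>
     word_val G v ` words Y = carrier G \<and>
     (\<forall>u\<in>words Y. \<forall>w\<in>words Y. word_val G v u = word_val G v w \<longleftrightarrow> word_eq Y R u w)"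

datatype gen = GA nat | GB nat | GX nat

primrec interp :: "(nat \<Rightarrow> 'a) \<Rightarrow> (nat \<Rightarrow> 'a) \<Rightarrow> (nat \<Rightarrow> 'a) \<Rightarrow> gen \<Rightarrow> 'a" where
  "interp a b x (GA i) = a i"
| "interp a b x (GB i) = b i"
| "interp a b x (GX i) = x i"

definition fuchsian_gens :: "nat \<Rightarrow> nat \<Rightarrow> gen set" where
  "fuchsian_gens g0 t = GA ` {1..g0} \<union> GB ` {1..g0} \<union> GX ` {1..t}"

text \<open>Commutators are $[a,b] = a b a^{-1} b^{-1}$.\<close>
definition long_relator :: "nat \<Rightarrow> nat \<Rightarrow> gen word" where
  "long_relator g0 t =
     map (\<lambda>j. (GX j, True)) [1..<t + 1] @
     concat (map (\<lambda>i. [(GA i, True), (GB i, True), (GA i, False), (GB i, False)]) [1..<g0 + 1])"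

definition fuchsian_relators :: "nat \<Rightarrow> nat \<Rightarrow> nat \<Rightarrow> gen word set" where
  "fuchsian_relators p g0 t =
     insert (long_relator g0 t) ((\<lambda>j. replicate p (GX j, True)) ` {1..t})"


section \<open>First homology, and the action of automorphisms on it\<close>

text \<open>For a torsion-free Fuchsian group \<open>F\<close>, \<open>H1 F\<close> is the first integral homology group of the
  orbit surface of \<open>F\<close>, written multiplicatively, and \<open>hclass F f\<close> is the class of \<open>f \<in> F\<close>.\<close>
definition H1 :: "(complex \<Rightarrow> complex) set \<Rightarrow> (complex \<Rightarrow> complex) set monoid" where
  "H1 F = subgroup_of_PSL2R F Mod derived (subgroup_of_PSL2R F) F"

definition hclass ::
  "(complex \<Rightarrow> complex) set \<Rightarrow> (complex \<Rightarrow> complex) \<Rightarrow> (complex \<Rightarrow> complex) set" where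
  "hclass F f = derived (subgroup_of_PSL2R F) F #>\<^bsub>subgroup_of_PSL2R F\<^esub> f"

definition conj_by :: "(complex \<Rightarrow> complex) \<Rightarrow> (complex \<Rightarrow> complex) \<Rightarrow> (complex \<Rightarrow> complex)" where
  "conj_by T f = T \<otimes>\<^bsub>PSL2R\<^esub> f \<otimes>\<^bsub>PSL2R\<^esub> inv\<^bsub>PSL2R\<^esub> T"

definition lifts_to ::
  "(complex \<Rightarrow> complex) set \<Rightarrow> (complex \<Rightarrow> complex) \<Rightarrow> (complex set \<Rightarrow> complex set) \<Rightarrow> bool" where
  "lifts_to F T h \<longleftrightarrow>
     T \<in> carrier PSL2R \<and> conj_by T ` F = F \<and>
     (\<forall>z\<in>upper_half_plane. h (orbit F z) = orbit F (T z))"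

text \<open>
  The automorphism of \<open>H1 F\<close> induced by a conformal automorphism \<open>h\<close> of the orbit surface: the class
  of \<open>f\<close> goes to that of $T f T^{-1}$, where \<open>T\<close> is any lift of \<open>h\<close> to the half plane. Two lifts
  differ by an element of \<open>F\<close>, so the result does not depend on \<open>T\<close>.
\<close>
definition homology_action ::
  "(complex \<Rightarrow> complex) set \<Rightarrow> (complex set \<Rightarrow> complex set) \<Rightarrow>
   (complex \<Rightarrow> complex) set \<Rightarrow> (complex \<Rightarrow> complex) set" where
  "homology_action F h c = (THE d. \<exists>T f. lifts_to F T h \<and> f \<in> c \<and> d = hclass F (conj_by T f))"


section \<open>Homology bases\<close>

definition Z_basis :: "('a, 'b) monoid_scheme \<Rightarrow> 'a set \<Rightarrow> bool" where
  "Z_basis A B \<longleftrightarrow>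
     B \<subseteq> carrier A \<and> generate A B = carrier A \<and>
     (\<forall>C c. finite C \<and> C \<subseteq> B \<and> finprod A (\<lambda>b. b [^]\<^bsub>A\<^esub> (c b :: int)) C = \<one>\<^bsub>A\<^esub> \<longrightarrow> (\<forall>b\<in>C. c b = 0))"

definition homology_basis :: "(complex \<Rightarrow> complex) set \<Rightarrow> (complex \<Rightarrow> complex) set set \<Rightarrow> bool" where
  "homology_basis F B \<longleftrightarrow> Z_basis (H1 F) B"

text \<open>
  With \<open>\<alpha>\<close> the action of \<open>h\<close>, the disjunction for \<open>k\<close> below says that
  $\gamma_0 = \alpha^m(\gamma)$ for some integer $m$ (namely $k$ or $-k$). The last conjunct is
  $\alpha^{p-1}(\gamma) = -(\gamma + \alpha(\gamma) + \dots + \alpha^{p-2}(\gamma))$.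
\<close>
definition adapted ::
  "nat \<Rightarrow> (complex \<Rightarrow> complex) set \<Rightarrow> (complex set \<Rightarrow> complex set) \<Rightarrow>
   (complex \<Rightarrow> complex) set set \<Rightarrow> bool" where
  "adapted p F h B \<longleftrightarrow>
     (let \<alpha> = homology_action F h in
      \<forall>\<gamma>0\<in>B. \<exists>\<gamma>\<in>carrier (H1 F).
        (\<exists>k :: nat. \<gamma>0 = (\<alpha> ^^ k) \<gamma> \<or> \<gamma> = (\<alpha> ^^ k) \<gamma>0) \<and>
        ((\<forall>j<p. (\<alpha> ^^ j) \<gamma> \<in> B) \<or>
         (\<forall>j<p - 1. (\<alpha> ^^ j) \<gamma> \<in> B) \<and>
         (\<alpha> ^^ (p - 1)) \<gamma> = inv\<^bsub>H1 F\<^esub> (finprod (H1 F) (\<lambda>j. (\<alpha> ^^ j) \<gamma>) {..<p - 1})))"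

text \<open>The index \<open>(s, j)\<close> stands for $h^j(A_i)$, $h^j(B_i)$ or $h^j(X_i)$ according as \<open>s\<close> is
  \<open>GA i\<close>, \<open>GB i\<close> or \<open>GX i\<close>.\<close>
definition basis_index :: "nat \<Rightarrow> nat \<Rightarrow> nat \<Rightarrow> (gen \<times> nat) set" where
  "basis_index p g0 t =
     (GA ` {1..g0} \<union> GB ` {1..g0}) \<times> {0..p - 1} \<union> GX ` {3..t} \<times> {0..p - 2}"

end

theory Submission
  imports Defs
begin

text \<open>
  Write $G$ for the presented group and $F$ for the kernel of $\phi$. The products of an element of
  the group generated by all $x_1^j a_i x_1^{-j}$, $x_1^j b_i x_1^{-j}$, $x_1^j X_i x_1^{-j}$ with a
  power of $x_1$ form a subgroup, which contains $x_2$ because of the long relator and hence is $G$.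
  Since $x_1^p = 1$, it follows that these conjugates generate $F$. In $F/[F,F]$ the relation
  $x_i^p = 1$ becomes $\sum_j h^j(X_i) = 0$, which eliminates $h^{p-1}(X_i)$.

  Independence is seen from dual functionals. A crossed homomorphism from $G$ to the functions on
  the residues modulo $p$ restricts to homomorphisms on $F$. It may be prescribed arbitrarily on
  $a_i$ and $b_i$, as $0$ on $x_1$, and as any function with sum $0$ on each $x_i$ with $i \ge 3$:
  the value on $x_2$ is then determined by the long relator and has sum $0$ as well, so that the
  relators $x_i^p$ are respected.

  Geometry enters only in showing that the action of $h$ on $F/[F,F]$ does not depend on the lift.
\<close>

section \<open>Crossed homomorphisms on presented groups\<close>

text \<open>Functions on the residues modulo \<open>p\<close> are encoded as periodic functions on
  the integers, so that translating the argument needs no reduction.\<close>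

definition mod_periodic :: "nat \<Rightarrow> (int \<Rightarrow> int) \<Rightarrow> bool" where
  "mod_periodic p f \<longleftrightarrow> (\<forall>k l. k mod int p = l mod int p \<longrightarrow> f k = f l)"

lemma mod_periodicD:
  "mod_periodic p f \<Longrightarrow> k mod int p = l mod int p \<Longrightarrow> f k = f l"
  unfolding mod_periodic_def by blast

lemma mod_periodic_neg_shift:
  assumes "mod_periodic p f"
  shows "mod_periodic p (\<lambda>k. - f (k + c))"
  unfolding mod_periodic_def
proof (intro allI impI)
  fix k l assume "k mod int p = l mod int p"
  then have "(k + c) mod int p = (l + c) mod int p"
    by (metis mod_add_left_eq)
  then have "f (k + c) = f (l + c)"
    by (rule mod_periodicD[OF assms])
  then show "- f (k + c) = - f (l + c)"
    by simp
qed

text \<open>Since \<open>m\<close> is a unit modulo \<open>p\<close>, the map is injective, and an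
  injective self-map of a finite set is bijective.\<close>

lemma bij_betw_arith_progression:
  assumes "coprime m (int p)" "p > 0"
  shows "bij_betw (\<lambda>r. nat ((k + int r * m) mod int p)) {..<p} {..<p}"
proof -
  have "inj_on (\<lambda>r. nat ((k + int r * m) mod int p)) {..<p}"
  proof (rule inj_onI)
    fix r s assume rs: "r \<in> {..<p}" "s \<in> {..<p}"
      and eq: "nat ((k + int r * m) mod int p) = nat ((k + int s * m) mod int p)"
    have "(k + int r * m) mod int p = (k + int s * m) mod int p"
      by (rule eq_nat_nat_iff[THEN iffD1, OF _ _ eq]) (use assms(2) in simp_all)
    then have "int p dvd (int r - int s) * m"
      by (simp add: mod_eq_dvd_iff algebra_simps)
    then have "int p dvd int r - int s"
      using assms by (simp add: coprime_commute coprime_dvd_mult_left_iff)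
    then have "int r mod int p = int s mod int p"
      by (simp add: mod_eq_dvd_iff)
    then show "r = s"
      using rs by simp
  qed
  moreover have "(\<lambda>r. nat ((k + int r * m) mod int p)) ` {..<p} \<subseteq> {..<p}"
    using assms by (auto simp: nat_less_iff)
  ultimately show ?thesis
    by (simp add: bij_betw_def endo_inj_surj)
qed

text \<open>Turns the condition imposed by a relator \<open>x_j^p\<close>, a sum along steps of
  \<open>\<phi> (x j)\<close>, into one on the sum over all residues.\<close>

lemma sum_arith_progression:
  assumes "coprime m (int p)" "p > 0" "mod_periodic p f"
  shows "(\<Sum>r<p. f (k + int r * m)) = (\<Sum>r<p. f (int r))"
proof -
  have "(\<Sum>r<p. f (k + int r * m)) = (\<Sum>r<p. f (int (nat ((k + int r * m) mod int p))))"
  proof (rule sum.cong[OF HOL.refl])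
    fix r
    have "int (nat ((k + int r * m) mod int p)) = (k + int r * m) mod int p"
      using assms(2) by simp
    then show "f (k + int r * m) = f (int (nat ((k + int r * m) mod int p)))"
      by (intro mod_periodicD[OF assms(3)]) (simp only: mod_mod_trivial)
  qed
  also have "\<dots> = (\<Sum>r<p. f (int r))"
    using sum.reindex_bij_betw[OF bij_betw_arith_progression[OF assms(1,2)], of "\<lambda>r. f (int r)"] .
  finally show ?thesis .
qed

lemma sum_residue_indicator:
  assumes "p > 0"
  shows "(\<Sum>r<p. of_bool (int r mod int p = c mod int p)) = (1 :: int)"
proof -
  have "(\<Sum>r<p. of_bool (int r mod int p = c mod int p)) =
      (\<Sum>r<p. if r = nat (c mod int p) then 1 else (0 :: int))"
    using assms by (intro sum.cong) (auto simp: nat_eq_iff2)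
  also have "\<dots> = 1"
    using assms by (simp add: nat_less_iff)
  finally show ?thesis .
qed

section \<open>Words and crossed sums\<close>

text \<open>An unreduced integer representative of the value of \<open>\<phi>\<close> on a word; see
  \<open>hom_word_val\<close>.\<close>

fun word_shift :: "('s \<Rightarrow> int) \<Rightarrow> 's word \<Rightarrow> int" where
  "word_shift \<theta> [] = 0"
| "word_shift \<theta> ((s, e) # w) = (if e then \<theta> s else - \<theta> s) + word_shift \<theta> w"

text \<open>Extends \<open>d\<close> from letters to words as a crossed homomorphism. Here \<open>k\<close> is a residue class
  modulo \<open>p\<close>, on which the letter \<open>s\<close> acts as translation by \<open>\<theta> s\<close>.\<close>
fun crossed_sum :: "('s \<Rightarrow> int) \<Rightarrow> ('s \<Rightarrow> int \<Rightarrow> int) \<Rightarrow> 's word \<Rightarrow> int \<Rightarrow> int" where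
  "crossed_sum \<theta> d [] k = 0"
| "crossed_sum \<theta> d ((s, e) # w) k =
     (if e then d s k + crossed_sum \<theta> d w (k + \<theta> s)
      else crossed_sum \<theta> d w (k - \<theta> s) - d s (k - \<theta> s))"

lemma word_shift_append [simp]: "word_shift \<theta> (u @ w) = word_shift \<theta> u + word_shift \<theta> w"
  by (induction u) auto

lemma crossed_sum_append [simp]:
  "crossed_sum \<theta> d (u @ w) k = crossed_sum \<theta> d u k + crossed_sum \<theta> d w (k + word_shift \<theta> u)"
  by (induction u arbitrary: k) (auto simp: algebra_simps)

lemma words_append [simp]: "u @ w \<in> words Y \<longleftrightarrow> u \<in> words Y \<and> w \<in> words Y"
  by (auto simp: words_def)

lemma words_Cons [simp]: "(s, e) # w \<in> words Y \<longleftrightarrow> s \<in> Y \<and> w \<in> words Y"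
  by (auto simp: words_def)

lemma words_Nil [simp]: "[] \<in> words Y"
  by (simp add: words_def)

lemma mod_periodic_crossed_sum:
  assumes "w \<in> words Y" "\<And>s. s \<in> Y \<Longrightarrow> mod_periodic p (d s)"
  shows "mod_periodic p (crossed_sum \<theta> d w)"
  unfolding mod_periodic_def using assms(1)
proof (induction w)
  case (Cons y w)
  obtain s e where y: "y = (s, e)" by force
  show ?case
  proof (intro allI impI)
    fix k l assume kl: "k mod int p = l mod int p"
    then have shifts: "(k + \<theta> s) mod int p = (l + \<theta> s) mod int p"
        "(k - \<theta> s) mod int p = (l - \<theta> s) mod int p"
      by (metis mod_add_left_eq, metis mod_diff_left_eq)
    have "s \<in> Y" "w \<in> words Y"
      using Cons.prems y by auto
    with Cons.IH shifts have
      "crossed_sum \<theta> d w (k + \<theta> s) = crossed_sum \<theta> d w (l + \<theta> s)"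
      "crossed_sum \<theta> d w (k - \<theta> s) = crossed_sum \<theta> d w (l - \<theta> s)" by blast+
    moreover have "d s k = d s l" "d s (k - \<theta> s) = d s (l - \<theta> s)"
      using assms(2)[OF \<open>s \<in> Y\<close>] kl shifts mod_periodicD by blast+
    ultimately show "crossed_sum \<theta> d (y # w) k = crossed_sum \<theta> d (y # w) l"
      by (simp add: y)
  qed
qed auto

lemma crossed_sum_cong:
  assumes "\<And>s e. (s, e) \<in> set w \<Longrightarrow> d s = d' s"
  shows "crossed_sum \<theta> d w k = crossed_sum \<theta> d' w k"
  using assms
proof (induction w arbitrary: k)
  case (Cons y w)
  obtain s e where y: "y = (s, e)" by force
  have "d s = d' s"
    by (rule Cons.prems[of s e]) (simp add: y)
  moreover have "crossed_sum \<theta> d w k = crossed_sum \<theta> d' w k" for k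
    by (rule Cons.IH, rule Cons.prems, rule list.set_intros(2))
  ultimately show ?case by (simp add: y)
qed simp

lemma crossed_sum_replicate:
  "crossed_sum \<theta> d (replicate n (s, True)) k = (\<Sum>r<n. d s (k + int r * \<theta> s))"
proof (induction n arbitrary: k)
  case (Suc n)
  show ?case
    unfolding sum.lessThan_Suc_shift by (simp add: Suc algebra_simps)
qed simp

text \<open>Reading a letter only moves the starting point of the progression, and the sums vanish
  for every starting point. This carries the sum condition from the letters over to the value forced
  on \<open>GX 2\<close>.\<close>

lemma progression_sum_crossed_sum:
  assumes "\<And>s e k. (s, e) \<in> set w \<Longrightarrow> (\<Sum>r<p. d s (k + int r * m)) = 0"
  shows "(\<Sum>r<p. crossed_sum \<theta> d w (k + int r * m)) = 0"
  using assms
proof (induction w arbitrary: k)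
  case (Cons y w)
  obtain s e where y: "y = (s, e)" by force
  have "(\<Sum>r<p. d s (k' + int r * m)) = 0" for k'
    by (rule Cons.prems[of s e]) (simp add: y)
  moreover have "(\<Sum>r<p. crossed_sum \<theta> d w (k' + int r * m)) = 0" for k'
    by (rule Cons.IH, rule Cons.prems, rule list.set_intros(2))
  moreover have "k + int r * m + \<theta> s = (k + \<theta> s) + int r * m"
      "k + int r * m - \<theta> s = (k - \<theta> s) + int r * m" for r
    by simp_all
  ultimately show ?case
    by (cases e) (simp_all only: y crossed_sum.simps if_True if_False sum.distrib sum_subtractf)
qed simp

text \<open>A letter followed by its inverse contributes opposite terms at the same residue. A
  relator contributes 0 and moves the argument of the remaining word by a multiple of
  \<open>p\<close>, which periodicity makes invisible.\<close>

lemma crossed_sum_word_eq: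
  assumes "word_eq Y R u w" "R \<subseteq> words Y"
    and per: "\<And>s. s \<in> Y \<Longrightarrow> mod_periodic p (d s)"
    and rel: "\<And>r k. r \<in> R \<Longrightarrow> crossed_sum \<theta> d r k = 0"
    and shift: "\<And>r. r \<in> R \<Longrightarrow> word_shift \<theta> r mod int p = 0"
  shows "crossed_sum \<theta> d u = crossed_sum \<theta> d w"
  using assms(1)
proof (induction rule: word_eq.induct)
  case (cancel u w s e)
  then show ?case by (auto simp: fun_eq_iff)
next
  case (relator u w r)
  have "crossed_sum \<theta> d w (k + word_shift \<theta> r) = crossed_sum \<theta> d w k" for k
  proof (rule mod_periodicD[OF mod_periodic_crossed_sum[OF relator(2) per]])
    show "(k + word_shift \<theta> r) mod int p = k mod int p"
      using shift[OF relator(3)] by (metis add.right_neutral mod_add_right_eq)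
  qed
  then show ?case
    by (simp add: fun_eq_iff rel[OF relator(3)] flip: add.assoc)
qed auto

section \<open>Evaluation of words and extension from generators\<close>

lemma word_val_append:
  assumes "group G" "v ` Y \<subseteq> carrier G" "u \<in> words Y" "w \<in> words Y"
  shows "word_val G v w \<in> carrier G \<and>
    word_val G v (u @ w) = word_val G v u \<otimes>\<^bsub>G\<^esub> word_val G v w"
proof -
  interpret group G by fact
  have closed: "word_val G v z \<in> carrier G" if "z \<in> words Y" for z
    using that assms(2) by (induction z) (auto simp: image_subset_iff)
  show ?thesis
    using assms(3) by (induction u) (use assms(2,4) closed in \<open>auto simp: m_assoc image_subset_iff\<close>)
qed

lemma hom_word_val:
  assumes "group G" "v ` Y \<subseteq> carrier G" "\<phi> \<in> hom G (integer_mod_group p)" "w \<in> words Y"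
  shows "\<phi> (word_val G v w) = word_shift (\<lambda>s. \<phi> (v s)) w mod int p"
proof -
  interpret group_hom G "integer_mod_group p" \<phi>
    using assms by (simp add: group_hom_def group_hom_axioms_def)
  show ?thesis
    using assms(4)
  proof (induction w)
    case Nil
    then show ?case using hom_one by (simp del: hom_one)
  next
    case (Cons y w)
    obtain s e where y: "y = (s, e)" by force
    have s: "v s \<in> carrier G" and w: "word_val G v w \<in> carrier G"
      using Cons.prems assms(1,2,4) word_val_append[of G v Y "[]" w] by (auto simp: y)
    have "\<phi> (inv\<^bsub>G\<^esub> v s) = (- \<phi> (v s)) mod int p"
      using s hom_closed by (subst hom_inv) auto
    then show ?case
      using Cons s w by (auto simp: y mod_simps)
  qed
qed

lemma word_val_relator:
  assumes "presentation G Y R v" "r \<in> R"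
  shows "word_val G v r = \<one>\<^bsub>G\<^esub>"
proof -
  have "word_eq Y R ([] @ r @ []) ([] @ [])"
    by (rule word_eq.relator) (use assms(2) in auto)
  then have "word_eq Y R r []"
    by simp
  moreover have "r \<in> words Y"
    using assms unfolding presentation_def by blast
  ultimately have "word_val G v r = word_val G v []"
    using assms(1) words_Nil[of Y] unfolding presentation_def by blast
  then show ?thesis
    by simp
qed

text \<open>The crossed analogue of von Dyck's theorem: by \<open>crossed_sum_word_eq\<close>, any
  word representing an element yields the same function. Vanishing on relators is required at every
  residue because a relator may stand behind any prefix.\<close>

lemma crossed_hom_extension:
  assumes pres: "presentation G Y R v" and \<phi>: "\<phi> \<in> hom G (integer_mod_group p)"
    and per: "\<And>s. s \<in> Y \<Longrightarrow> mod_periodic p (d s)"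
    and rel: "\<And>r k. r \<in> R \<Longrightarrow> crossed_sum (\<lambda>s. \<phi> (v s)) d r k = 0"
  obtains D where
    "\<And>f g k. f \<in> carrier G \<Longrightarrow> g \<in> carrier G \<Longrightarrow> D (f \<otimes>\<^bsub>G\<^esub> g) k = D f k + D g (k + \<phi> f)"
    "\<And>f. f \<in> carrier G \<Longrightarrow> mod_periodic p (D f)"
    "\<And>s. s \<in> Y \<Longrightarrow> D (v s) = d s"
proof -
  let ?\<theta> = "\<lambda>s. \<phi> (v s)"
  have G: "group G" "v ` Y \<subseteq> carrier G" "R \<subseteq> words Y" "word_val G v ` words Y = carrier G"
    and eq: "\<And>u w. u \<in> words Y \<Longrightarrow> w \<in> words Y \<Longrightarrow>
      word_val G v u = word_val G v w \<longleftrightarrow> word_eq Y R u w"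
    using pres by (auto simp: presentation_def)
  interpret group_hom G "integer_mod_group p" \<phi>
    using G \<phi> by (simp add: group_hom_def group_hom_axioms_def)
  have shift: "word_shift ?\<theta> r mod int p = 0" if "r \<in> R" for r
  proof -
    have r: "r \<in> words Y" using that G by auto
    show ?thesis
      using hom_word_val[OF G(1,2) \<phi> r] hom_one word_val_relator[OF pres that] by simp
  qed
  define D where "D f = crossed_sum ?\<theta> d (SOME w. w \<in> words Y \<and> word_val G v w = f)" for f
  have D: "D (word_val G v w) = crossed_sum ?\<theta> d w" if w: "w \<in> words Y" for w
  proof -
    define u where "u = (SOME u. u \<in> words Y \<and> word_val G v u = word_val G v w)"
    have "u \<in> words Y \<and> word_val G v u = word_val G v w"
      unfolding u_def by (rule someI[of _ w]) (use w in auto)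
    then have "word_eq Y R u w"
      using eq w by blast
    then have "crossed_sum ?\<theta> d u = crossed_sum ?\<theta> d w"
      using G(3) per rel shift by (rule crossed_sum_word_eq)
    then show ?thesis
      by (simp add: D_def u_def)
  qed
  show thesis
  proof (rule that[of D])
    fix f g k assume "f \<in> carrier G" "g \<in> carrier G"
    then obtain u w where uw: "u \<in> words Y" "f = word_val G v u" "w \<in> words Y" "g = word_val G v w"
      using G(4) by (metis imageE)
    have "D (f \<otimes>\<^bsub>G\<^esub> g) k = crossed_sum ?\<theta> d (u @ w) k"
      using uw word_val_append[OF G(1,2), of u w] D[of "u @ w"] by simp
    also have "\<dots> = crossed_sum ?\<theta> d u k + crossed_sum ?\<theta> d w (k + word_shift ?\<theta> u)"
      by simp
    \<comment> \<open>The two shifts agree only modulo \<open>p\<close>, so periodicity is what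
      identifies the values.\<close>
    also have "crossed_sum ?\<theta> d w (k + word_shift ?\<theta> u) = crossed_sum ?\<theta> d w (k + \<phi> f)"
      by (rule mod_periodicD[OF mod_periodic_crossed_sum[where d = d, OF uw(3) per]])
        (simp_all add: uw(2) hom_word_val[OF G(1,2) \<phi> uw(1)] mod_simps)
    finally show "D (f \<otimes>\<^bsub>G\<^esub> g) k = D f k + D g (k + \<phi> f)"
      using uw D by simp
  next
    fix f assume "f \<in> carrier G"
    then obtain w where "w \<in> words Y" "f = word_val G v w"
      using G(4) by (metis imageE)
    then show "mod_periodic p (D f)"
      using D mod_periodic_crossed_sum[where d = d, OF _ per] by simp
  next
    fix s assume "s \<in> Y"
    then show "D (v s) = d s"
      using D[of "[(s, True)]"] G(2) by (auto simp: image_subset_iff fun_eq_iff)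
  qed
qed

section \<open>Crossed homomorphisms on the Fuchsian presentation\<close>

text \<open>The letters of a commutator do not move the argument, so each letter and its inverse are
  evaluated at the same residue and cancel.\<close>

lemma crossed_sum_commutators:
  assumes "\<And>i. i \<in> set is \<Longrightarrow> \<theta> (GA i) = 0 \<and> \<theta> (GB i) = 0"
  shows "crossed_sum \<theta> d
    (concat (map (\<lambda>i. [(GA i, True), (GB i, True), (GA i, False), (GB i, False)]) is)) k = 0"
  using assms by (induction "is" arbitrary: k) auto

lemma upt_1_Suc: "t \<ge> 2 \<Longrightarrow> [1..<t + 1] = 1 # 2 # [3..<t + 1]"
  by (simp add: upt_conv_Cons numeral_2_eq_2 numeral_3_eq_3)

text \<open>Supplies the crossed homomorphisms behind the dual functionals. The entry at
  \<open>GX 2\<close> is replaced by the value that the long relator forces, hence the exception in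
  the last conclusion.\<close>

lemma fuchsian_crossed_hom:
  assumes p: "prime p"
    and pres: "presentation G (fuchsian_gens g0 t) (fuchsian_relators p g0 t) (interp a b x)"
    and \<phi>: "\<phi> \<in> hom G (integer_mod_group p)"
    and \<phi>ab: "\<And>i. i \<in> {1..g0} \<Longrightarrow> \<phi> (a i) = 0 \<and> \<phi> (b i) = 0"
    and \<phi>x: "\<And>j. j \<in> {1..t} \<Longrightarrow> coprime (\<phi> (x j)) (int p)"
    and per: "\<And>s. mod_periodic p (d s)"
    and d1: "d (GX 1) = (\<lambda>k. 0)"
    and zero: "\<And>j. (\<Sum>r<p. d (GX j) (int r)) = 0"
  obtains D where
    "\<And>f g k. f \<in> carrier G \<Longrightarrow> g \<in> carrier G \<Longrightarrow> D (f \<otimes>\<^bsub>G\<^esub> g) k = D f k + D g (k + \<phi> f)"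
    "\<And>f. f \<in> carrier G \<Longrightarrow> mod_periodic p (D f)"
    "\<And>s. s \<in> fuchsian_gens g0 t \<Longrightarrow> s \<noteq> GX 2 \<Longrightarrow> D (interp a b x s) = d s"
proof -
  have p0: "p > 0" using p by (simp add: prime_gt_0_nat)
  define \<theta> where "\<theta> s = \<phi> (interp a b x s)" for s
  define w where "w = map (\<lambda>j. (GX j, True)) [3..<t + 1]"
  \<comment> \<open>the long relator forces this value at $x_2$\<close>
  define e where "e = d(GX 2 := \<lambda>k. - crossed_sum \<theta> d w (k + \<theta> (GX 2)))"
  \<comment> \<open>The step \<open>m\<close> is independent of \<open>j\<close>: the letters of
    \<open>w\<close> have to be summed along one common progression to control the value at
    \<open>GX 2\<close>.\<close>
  have zero': "(\<Sum>r<p. d (GX j) (k + int r * m)) = 0" if "coprime m (int p)" for j k m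
    using sum_arith_progression[OF that p0 per] zero by simp
  have e_per: "mod_periodic p (e s)" for s
  proof (cases "s = GX 2")
    case True
    have "mod_periodic p (crossed_sum \<theta> d w)"
      by (rule mod_periodic_crossed_sum[of _ UNIV]) (use per in \<open>auto simp: words_def\<close>)
    then show ?thesis
      by (simp add: True e_def mod_periodic_neg_shift)
  qed (use per in \<open>simp add: e_def\<close>)
  have e_zero: "(\<Sum>r<p. e (GX j) (k + int r * m)) = 0" if m: "coprime m (int p)" for j k m
  proof (cases "j = 2")
    case True
    have "(\<Sum>r<p. crossed_sum \<theta> d w ((k + \<theta> (GX 2)) + int r * m)) = 0"
      by (rule progression_sum_crossed_sum) (use zero'[OF m] in \<open>auto simp: w_def\<close>)
    then show ?thesis
      by (simp add: True e_def sum_negf algebra_simps)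
  qed (use zero'[OF m] in \<open>simp add: e_def\<close>)
  have "crossed_sum \<theta> e r k = 0" if r: "r \<in> fuchsian_relators p g0 t" for r k
  proof -
    consider "r = long_relator g0 t" | j where "j \<in> {1..t}" "r = replicate p (GX j, True)"
      using r unfolding fuchsian_relators_def by blast
    then show ?thesis
    proof cases
      case 1
      have comm: "crossed_sum \<theta> e (concat (map (\<lambda>i.
          [(GA i, True), (GB i, True), (GA i, False), (GB i, False)]) [1..<g0 + 1])) l = 0" for l
        by (rule crossed_sum_commutators) (use \<phi>ab in \<open>auto simp: \<theta>_def\<close>)
      have "crossed_sum \<theta> e (map (\<lambda>j. (GX j, True)) [1..<t + 1]) k = 0"
      proof (cases "t \<ge> 2")
        case True
        have "crossed_sum \<theta> e w l = crossed_sum \<theta> d w l" for l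
          by (rule crossed_sum_cong) (auto simp: w_def e_def)
        then show ?thesis
          unfolding upt_1_Suc[OF True] list.map(2) w_def[symmetric]
          by (simp add: e_def d1[unfolded One_nat_def])
      next
        \<comment> \<open>For \<open>t < 2\<close> the only letter that can occur is
          \<open>GX 1\<close>, where \<open>d\<close> vanishes.\<close>
        case False
        then have "t = 0 \<or> t = 1" by auto
        then show ?thesis by (auto simp: e_def d1[unfolded One_nat_def])
      qed
      then show ?thesis
        unfolding 1 long_relator_def by (simp only: crossed_sum_append comm add_0_left)
    next
      case 2
      then show ?thesis
        using e_zero[OF \<phi>x, of j] by (simp add: crossed_sum_replicate \<theta>_def)
    qed
  qed
  then have rel: "crossed_sum (\<lambda>s. \<phi> (interp a b x s)) e r k = 0"
    if "r \<in> fuchsian_relators p g0 t" for r k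
    using that by (simp add: \<theta>_def[abs_def])
  show thesis
  proof (rule crossed_hom_extension[where d = e, OF pres \<phi> e_per rel])
    fix D
    assume "\<And>f g k. f \<in> carrier G \<Longrightarrow> g \<in> carrier G \<Longrightarrow>
        D (f \<otimes>\<^bsub>G\<^esub> g) k = D f k + D g (k + \<phi> f)"
      and "\<And>f. f \<in> carrier G \<Longrightarrow> mod_periodic p (D f)"
      and "\<And>s. s \<in> fuchsian_gens g0 t \<Longrightarrow> D (interp a b x s) = e s"
    then show thesis
      by (intro that[of D]) (simp_all add: e_def)
  qed
qed

section \<open>Bases of abelian groups from dual functionals\<close>

lemma hom_integer_finprod:
  assumes "comm_group A" "\<psi> \<in> hom A integer_group" "finite C" "g \<in> C \<rightarrow> carrier A"
  shows "\<psi> (finprod A g C) = (\<Sum>c\<in>C. \<psi> (g c))"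
proof -
  interpret A: comm_group A by fact
  interpret group_hom A integer_group \<psi>
    using assms(2) by (simp add: group_hom_def group_hom_axioms_def A.is_group)
  show ?thesis
    using assms(3,4)
  proof (induction C)
    case empty
    then show ?case using hom_one by (simp del: hom_one)
  next
    case (insert c C)
    then show ?case using hom_mult by (simp add: Pi_iff del: hom_mult)
  qed
qed

text \<open>A dual functional applied to a relation isolates one coefficient, which gives
  independence; it also separates its own index from all others, which gives injectivity.\<close>

lemma Z_basis_of_dual_family:
  assumes A: "comm_group A" and closed: "f ` I \<subseteq> carrier A"
    and gen: "carrier A \<subseteq> generate A (f ` I)"
    and dual: "\<And>i. i \<in> I \<Longrightarrow> \<exists>\<psi>\<in>hom A integer_group. \<forall>j\<in>I. \<psi> (f j) = of_bool (i = j)"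
  shows "inj_on f I \<and> Z_basis A (f ` I)"
proof
  interpret A: comm_group A by fact
  show inj: "inj_on f I"
  proof (rule inj_onI)
    fix i j assume ij: "i \<in> I" "j \<in> I" "f i = f j"
    obtain \<psi> where \<psi>: "\<And>k. k \<in> I \<Longrightarrow> \<psi> (f k) = (of_bool (i = k) :: int)"
      using dual[OF ij(1)] by blast
    show "i = j"
      using \<psi>[OF ij(1)] \<psi>[OF ij(2)] ij(3) by (simp split: if_splits)
  qed
  have "c b = 0" if C: "finite C" "C \<subseteq> f ` I" "b \<in> C"
    and rel: "finprod A (\<lambda>b. b [^]\<^bsub>A\<^esub> c b) C = \<one>\<^bsub>A\<^esub>" for C b and c :: "_ \<Rightarrow> int"
  proof -
    obtain i where i: "i \<in> I" "b = f i" using C by blast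
    obtain \<psi> where hom: "\<psi> \<in> hom A integer_group"
      and \<psi>: "\<And>j. j \<in> I \<Longrightarrow> \<psi> (f j) = of_bool (i = j)"
      using dual[OF i(1)] by blast
    interpret group_hom A integer_group \<psi>
      by (intro group_hom.intro group_hom_axioms.intro hom A.is_group group_integer_group)
    have "\<psi> (b' [^]\<^bsub>A\<^esub> c b') = (if b' = b then c b' else 0)" if "b' \<in> C" for b'
    proof -
      obtain j where j: "j \<in> I" "b' = f j"
        using C(2) \<open>b' \<in> C\<close> by (auto simp: subset_iff)
      then have "b' \<in> carrier A"
        using closed by blast
      then have "\<psi> (b' [^]\<^bsub>A\<^esub> c b') = c b' * of_bool (i = j)"
        by (simp only: hom_int_pow group_int_pow_integer_group j(2) \<psi>[OF j(1)])
      moreover have "b' = b \<longleftrightarrow> i = j"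
        using i j inj by (metis inj_onD)
      ultimately show ?thesis by simp
    qed
    then have "(\<Sum>b'\<in>C. \<psi> (b' [^]\<^bsub>A\<^esub> c b')) = (\<Sum>b'\<in>C. if b' = b then c b' else 0)"
      by (rule sum.cong[OF HOL.refl])
    also have "\<dots> = c b"
      using C by simp
    also have "(\<Sum>b'\<in>C. \<psi> (b' [^]\<^bsub>A\<^esub> c b')) = \<psi> (finprod A (\<lambda>b. b [^]\<^bsub>A\<^esub> c b) C)"
      using C closed by (intro hom_integer_finprod[symmetric] A hom) auto
    also have "\<dots> = 0"
      using rel hom_one by simp
    finally show ?thesis by simp
  qed
  moreover have "generate A (f ` I) = carrier A"
    using gen A.generate_incl[OF closed] by blast
  ultimately show "Z_basis A (f ` I)"
    unfolding Z_basis_def using closed by blast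
qed

section \<open>The kernel of a cyclic quotient of a Fuchsian presentation\<close>

lemma word_val_in_subgroup:
  assumes "group G" "subgroup W G" "v ` Y \<subseteq> W" "w \<in> words Y"
  shows "word_val G v w \<in> W"
proof -
  interpret group G by fact
  interpret W: subgroup W G by fact
  show ?thesis
    using assms(4,3) by (induction w) (auto simp: image_subset_iff)
qed

text \<open>The exponent \<open>m i\<close> is chosen so that $\overline{x_i} = x_1^{m_i}$.\<close>
locale cyclic_cover =
  fixes G (structure) and p g0 t :: nat and a b x X :: "nat \<Rightarrow> 'a" and m :: "nat \<Rightarrow> int"
    and \<phi> :: "'a \<Rightarrow> int"
  assumes prime: "prime p" and t_pos: "t > 0"
    and pres: "presentation G (fuchsian_gens g0 t) (fuchsian_relators p g0 t) (interp a b x)"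
    and hom: "\<phi> \<in> hom G (integer_mod_group p)"
    and phi_ab: "\<And>i. i \<in> {1..g0} \<Longrightarrow> \<phi> (a i) = 0 \<and> \<phi> (b i) = 0"
    and phi_x: "\<And>j. j \<in> {1..t} \<Longrightarrow> \<phi> (x j) \<noteq> 0"
    and phi_power: "\<And>i. i \<in> {3..t} \<Longrightarrow> \<phi> (x 1 [^] m i) = \<phi> (x i)"
    and X_def: "\<And>i. i \<in> {3..t} \<Longrightarrow> X i = x i \<otimes> inv (x 1 [^] m i)"
begin

declare One_nat_def [simp del]

sublocale group G
  using pres unfolding presentation_def by blast

sublocale phi: group_hom G "integer_mod_group p" \<phi>
  using hom by (simp add: group_hom_def group_hom_axioms_def is_group)

definition K where "K = kernel G (integer_mod_group p) \<phi>"

text \<open>\<open>Ab\<close> and \<open>cl\<close> are modelled on \<open>H1\<close> and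
  \<open>hclass\<close>, with which they coincide once \<open>G\<close> is the Fuchsian group. Until
  then the argument is pure algebra.\<close>

definition Ab where "Ab = (G\<lparr>carrier := K\<rparr>) Mod (derived (G\<lparr>carrier := K\<rparr>) K)"

definition cl where "cl f = derived (G\<lparr>carrier := K\<rparr>) K #>\<^bsub>G\<lparr>carrier := K\<rparr>\<^esub> f"

definition conj_pow where "conj_pow j f = x 1 [^] (j :: int) \<otimes> f \<otimes> inv (x 1 [^] j)"

definition gens where "gens = GA ` {1..g0} \<union> GB ` {1..g0} \<union> GX ` {3..t}"

text \<open>Reads the symbol \<open>GX i\<close> as \<open>X i\<close>, whereas the presentation
  reads it as \<open>x i\<close>.\<close>

abbreviation val where "val \<equiv> interp a b X"

definition basis_family where "basis_family = (\<lambda>(s, j :: nat). cl (conj_pow (int j) (val s)))"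

section \<open>Values of \<open>\<phi>\<close> and powers of \<open>x 1\<close>\<close>

lemma p_pos: "p > 0"
  using prime by (simp add: prime_gt_0_nat)

lemma p_ge_2: "p \<ge> 2"
  using prime by (rule prime_ge_2_nat)

lemma interp_closed: "s \<in> fuchsian_gens g0 t \<Longrightarrow> interp a b x s \<in> carrier G"
  using pres unfolding presentation_def by blast

lemma x_closed: "j \<in> {1..t} \<Longrightarrow> x j \<in> carrier G"
  using interp_closed[of "GX j"] by (auto simp: fuchsian_gens_def)

lemma x1 [simp]: "x 1 \<in> carrier G"
  using x_closed[of 1] t_pos by auto

lemma phi_range: "f \<in> carrier G \<Longrightarrow> 0 \<le> \<phi> f \<and> \<phi> f < int p"
  using phi.hom_closed[of f] p_pos by (auto simp: carrier_integer_mod_group)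

lemma phi_mult: "f \<in> carrier G \<Longrightarrow> g \<in> carrier G \<Longrightarrow> \<phi> (f \<otimes> g) = (\<phi> f + \<phi> g) mod int p"
  using phi.hom_mult[of f g] by simp

lemma phi_one: "\<phi> \<one> = 0"
  using phi.hom_one by simp

lemma phi_inv: "f \<in> carrier G \<Longrightarrow> \<phi> (inv f) = (- \<phi> f) mod int p"
  using phi.hom_inv[of f] phi.hom_closed[of f] by simp

lemma phi_pow_x1: "\<phi> (x 1 [^] (j :: int)) = (j * \<phi> (x 1)) mod int p"
  using phi.hom_int_pow[of "x 1" j] x1 by (simp add: int_pow_integer_mod_group)

lemma coprime_phi_x: "j \<in> {1..t} \<Longrightarrow> coprime (\<phi> (x j)) (int p)"
proof -
  assume j: "j \<in> {1..t}"
  have "0 < \<phi> (x j)" "\<phi> (x j) < int p"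
    using phi_x[OF j] phi_range[OF x_closed[OF j]] by auto
  then have "\<not> int p dvd \<phi> (x j)"
    by (rule zdvd_not_zless)
  then show ?thesis
    using prime by (simp add: prime_imp_coprime coprime_commute)
qed

text \<open>Modulo \<open>p\<close>, the product of \<open>m i\<close> and
  \<open>\<phi> (x 1)\<close> is \<open>\<phi> (x i)\<close>, which is nonzero.\<close>

lemma coprime_m: "i \<in> {3..t} \<Longrightarrow> coprime (m i) (int p)"
proof -
  assume i: "i \<in> {3..t}"
  then have "\<phi> (x i) = (m i * \<phi> (x 1)) mod int p" "\<phi> (x i) \<noteq> 0"
    using phi_power[OF i] phi_x[of i] by (auto simp: phi_pow_x1)
  then have "\<not> int p dvd m i"
    by (metis dvd_mult2 dvd_imp_mod_0)
  then show ?thesis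
    using prime by (simp add: prime_imp_coprime coprime_commute)
qed

lemma x_pow_p: "j \<in> {1..t} \<Longrightarrow> x j [^] p = \<one>"
proof -
  assume j: "j \<in> {1..t}"
  have "word_val G (interp a b x) (replicate n (GX j, True)) = x j [^] n" for n :: nat
    by (induction n) (simp_all add: nat_pow_Suc2[OF x_closed[OF j], symmetric])
  moreover have "replicate p (GX j, True) \<in> fuchsian_relators p g0 t"
    using j unfolding fuchsian_relators_def by blast
  ultimately show ?thesis
    using word_val_relator[OF pres] by metis
qed

lemma x1_pow_mod: "x 1 [^] (j mod int p) = x 1 [^] (j :: int)"
proof -
  have "x 1 [^] p = \<one>"
    by (rule x_pow_p) (use t_pos in auto)
  then have "x 1 [^] int p = \<one>"
    by (simp only: int_pow_int)
  then have "x 1 [^] (int p * (j div int p)) = \<one>"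
    by (simp only: int_pow_pow[OF x1, symmetric] int_pow_one)
  then have "x 1 [^] (int p * (j div int p) + j mod int p) = \<one> \<otimes> x 1 [^] (j mod int p)"
    by (simp only: int_pow_mult[OF x1])
  then show ?thesis
    by (simp only: mult_div_mod_eq l_one[OF int_pow_closed[OF x1]])
qed

lemma K_iff: "f \<in> K \<longleftrightarrow> f \<in> carrier G \<and> \<phi> f = 0"
  by (simp add: K_def kernel_def)

sublocale K: subgroup K G
  unfolding K_def by (rule phi.subgroup_kernel)

declare K.mem_carrier [simp del]

section \<open>Conjugation by powers of \<open>x 1\<close>\<close>

lemma inv_pow_cancel: "f \<in> carrier G \<Longrightarrow> inv (x 1 [^] (j :: int)) \<otimes> (x 1 [^] j \<otimes> f) = f"
  by (simp add: m_assoc[symmetric])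

lemma conj_pow_mod: "conj_pow (j mod int p) f = conj_pow j f"
  by (simp only: conj_pow_def x1_pow_mod)

lemma conj_pow_closed [simp]: "f \<in> carrier G \<Longrightarrow> conj_pow j f \<in> carrier G"
  by (simp add: conj_pow_def)

lemma conj_pow_one [simp]: "conj_pow j \<one> = \<one>"
  by (simp add: conj_pow_def)

lemma conj_pow_0 [simp]: "f \<in> carrier G \<Longrightarrow> conj_pow 0 f = f"
  by (simp add: conj_pow_def)

lemma conj_pow_mult: "f \<in> carrier G \<Longrightarrow> g \<in> carrier G \<Longrightarrow> conj_pow j (f \<otimes> g) = conj_pow j f \<otimes> conj_pow j g"
  by (simp add: conj_pow_def m_assoc inv_pow_cancel)

lemma conj_pow_inv: "f \<in> carrier G \<Longrightarrow> conj_pow j (inv f) = inv (conj_pow j f)"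
  by (simp add: conj_pow_def m_assoc inv_mult_group)

lemma conj_pow_conj_pow: "f \<in> carrier G \<Longrightarrow> conj_pow i (conj_pow j f) = conj_pow (i + j) f"
  by (simp add: conj_pow_def m_assoc inv_mult_group int_pow_mult)

lemma conj_pow_pow: "conj_pow j f \<otimes> x 1 [^] j = x 1 [^] j \<otimes> f" if "f \<in> carrier G"
  using that by (simp add: conj_pow_def m_assoc)

lemma conj_pow_in_K: "f \<in> K \<Longrightarrow> conj_pow j f \<in> K"
  using phi_range[of "x 1 [^] j"]
  by (simp add: K_iff conj_pow_def phi_mult phi_inv mod_simps)

lemma val_in_K: "s \<in> gens \<Longrightarrow> val s \<in> K"
proof -
  assume "s \<in> gens"
  then consider i where "i \<in> {1..g0}" "s = GA i \<or> s = GB i" | i where "i \<in> {3..t}" "s = GX i"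
    by (auto simp: gens_def)
  then show ?thesis
  proof cases
    case 1
    then show ?thesis
      using phi_ab[of i] interp_closed[of s] by (auto simp: K_iff fuchsian_gens_def)
  next
    case 2
    then show ?thesis
      using X_def[of i] x_closed[of i] phi_power[of i] phi_range[of "x i"]
      by (auto simp: K_iff phi_mult phi_inv mod_simps)
  qed
qed

lemma val_closed: "s \<in> gens \<Longrightarrow> val s \<in> carrier G"
  using val_in_K K.subset by blast

lemma X_mult: "i \<in> {3..t} \<Longrightarrow> X i \<otimes> x 1 [^] m i = x i"
  using X_def[of i] x_closed[of i] by (simp add: m_assoc)

section \<open>The abelianized kernel and the relation among the conjugates of
  \<open>X i\<close>\<close>

sublocale Ab: comm_group Ab
  unfolding Ab_def
  using derived_quot_of_subgroup_is_comm_group[OF K.subgroup_axioms] derived_consistent[of K K]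
    K.subgroup_axioms by simp

lemma derived_normal: "derived (G\<lparr>carrier := K\<rparr>) K \<lhd> G\<lparr>carrier := K\<rparr>"
  using derived_subgroup_is_normal[OF K.subgroup_axioms] derived_consistent[of K K]
    K.subgroup_axioms by simp

sublocale cl: group_hom "G\<lparr>carrier := K\<rparr>" Ab cl
proof -
  have "cl \<in> hom (G\<lparr>carrier := K\<rparr>) Ab"
    unfolding Ab_def cl_def by (rule normal.r_coset_hom_Mod[OF derived_normal])
  then show "group_hom (G\<lparr>carrier := K\<rparr>) Ab cl"
    using K.subgroup_is_group[OF is_group] Ab.is_group
    by (simp add: group_hom_def group_hom_axioms_def)
qed

lemma carrier_Ab: "carrier Ab = cl ` K"
  by (simp add: Ab_def carrier_FactGroup cl_def[abs_def])

lemma cl_closed [simp]: "f \<in> K \<Longrightarrow> cl f \<in> carrier Ab"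
  using cl.hom_closed by simp

lemma cl_mult: "f \<in> K \<Longrightarrow> g \<in> K \<Longrightarrow> cl (f \<otimes> g) = cl f \<otimes>\<^bsub>Ab\<^esub> cl g"
  using cl.hom_mult by simp

lemma cl_one: "cl \<one> = \<one>\<^bsub>Ab\<^esub>"
  using cl.hom_one by simp

lemma cl_inv: "f \<in> K \<Longrightarrow> cl (inv f) = inv\<^bsub>Ab\<^esub> (cl f)"
  using cl.hom_inv[of f] K.subgroup_axioms by simp

text \<open>Since $x_i = X_i x_1^{m_i}$, the relation $x_i^p = 1$ says that the product of the conjugates
  of $X_i$ by $1, x_1^{m_i}, x_1^{2 m_i}, \dots$ is trivial, and these exponents run through all
  residues.\<close>
lemma finprod_conj_X:
  assumes i: "i \<in> {3..t}"
  shows "finprod Ab (\<lambda>k. cl (conj_pow (int k) (X i))) {..<p} = \<one>\<^bsub>Ab\<^esub>"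
proof -
  have X: "X i \<in> K" "X i \<in> carrier G"
    using val_in_K[of "GX i"] K.subset i by (auto simp: gens_def)
  have xi: "x i \<in> carrier G"
    using x_closed[of i] i by auto
  \<comment> \<open>\<open>P r\<close> is the product of the first \<open>r\<close> conjugates of
    \<open>X i\<close>, by the powers of \<open>x 1\<close> with exponents
    \<open>0, m i, 2 * m i\<close> and so on. At \<open>r = p\<close> both of its factors are
    trivial.\<close>
  define P where "P r = x i [^] r \<otimes> x 1 [^] (- (int r * m i))" for r :: nat
  have P_Suc: "P (Suc r) = P r \<otimes> conj_pow (int r * m i) (X i)" for r
  proof -
    have "P (Suc r) = x i [^] r \<otimes> (X i \<otimes> x 1 [^] m i) \<otimes> x 1 [^] (- m i - int r * m i)"
      using xi X_mult[OF i] by (simp add: P_def algebra_simps)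
    also have "\<dots> = x i [^] r \<otimes> X i \<otimes> (x 1 [^] m i \<otimes> x 1 [^] (- m i - int r * m i))"
      using xi X by (simp add: m_assoc)
    also have "x 1 [^] m i \<otimes> x 1 [^] (- m i - int r * m i) = x 1 [^] (- (int r * m i))"
      by (simp flip: int_pow_mult)
    also have "x i [^] r \<otimes> X i \<otimes> x 1 [^] (- (int r * m i)) =
        x i [^] r \<otimes> (x 1 [^] (- (int r * m i)) \<otimes> x 1 [^] (int r * m i)) \<otimes> X i \<otimes>
        x 1 [^] (- (int r * m i))"
      using xi X by (simp flip: int_pow_mult)
    also have "\<dots> = P r \<otimes> conj_pow (int r * m i) (X i)"
      using xi X by (simp add: P_def conj_pow_def m_assoc int_pow_neg inv_pow_cancel)
    finally show ?thesis .
  qed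
  have "P r \<in> K \<and> cl (P r) = finprod Ab (\<lambda>k. cl (conj_pow (int k * m i) (X i))) {..<r}" for r
  proof (induction r)
    case 0
    then show ?case by (simp add: P_def cl_one)
  next
    case (Suc r)
    have "cl (P (Suc r)) = cl (P r) \<otimes>\<^bsub>Ab\<^esub> cl (conj_pow (int r * m i) (X i))"
      unfolding P_Suc using Suc X by (intro cl_mult conj_pow_in_K) auto
    also have "\<dots> = finprod Ab (\<lambda>k. cl (conj_pow (int k * m i) (X i))) {..<Suc r}"
      using Suc X by (simp add: lessThan_Suc Ab.m_comm conj_pow_in_K Pi_iff Ab.finprod_closed)
    finally show ?case
      using Suc X by (simp add: P_Suc conj_pow_in_K)
  qed
  from this[of p] have "finprod Ab (\<lambda>k. cl (conj_pow (int k * m i) (X i))) {..<p} = cl (P p)"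
    by simp
  also have "P p = \<one>"
  proof -
    have "x 1 [^] (- (int p * m i)) = x 1 [^] (- (int p * m i) mod int p)"
      by (rule x1_pow_mod[symmetric])
    then show ?thesis
      using x_pow_p[of i] i by (simp add: P_def)
  qed
  also have "cl \<one> = \<one>\<^bsub>Ab\<^esub>"
    by (rule cl_one)
  finally have *: "finprod Ab (\<lambda>k. cl (conj_pow (int k * m i) (X i))) {..<p} = \<one>\<^bsub>Ab\<^esub>" .
  \<comment> \<open>Sorts the exponents \<open>k * m i\<close> by their residues; the summand
    \<open>0\<close> matches the form of \<open>bij_betw_arith_progression\<close>.\<close>
  let ?\<pi> = "\<lambda>k. nat ((0 + int k * m i) mod int p)"
  have bij: "bij_betw ?\<pi> {..<p} {..<p}"
    by (rule bij_betw_arith_progression[OF coprime_m[OF i] p_pos])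
  have "finprod Ab (\<lambda>k. cl (conj_pow (int k) (X i))) (?\<pi> ` {..<p}) =
      finprod Ab (\<lambda>k. cl (conj_pow (int (?\<pi> k)) (X i))) {..<p}"
    using bij X by (intro Ab.finprod_reindex) (auto simp: bij_betw_def conj_pow_in_K)
  moreover have "conj_pow (int (?\<pi> k)) (X i) = conj_pow (int k * m i) (X i)" for k
    using p_pos conj_pow_mod[of "int k * m i" "X i"] by simp
  ultimately show ?thesis
    using * bij by (simp only: bij_betw_def)
qed

text \<open>Solves the relation \<open>finprod_conj_X\<close> for its last factor. It serves twice:
  to reach the missing generator of \<open>Ab\<close>, and as case (2) of adaptedness.\<close>

lemma cl_conj_X_last:
  assumes i: "i \<in> {3..t}"
  shows "cl (conj_pow (int (p - 1)) (X i)) =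
    inv\<^bsub>Ab\<^esub> (finprod Ab (\<lambda>k. cl (conj_pow (int k) (X i))) {..<p - 1})"
proof -
  have X: "X i \<in> K"
    using val_in_K[of "GX i"] i by (auto simp: gens_def)
  have "{..<p} = insert (p - 1) {..<p - 1}"
    using p_pos by auto
  then have "cl (conj_pow (int (p - 1)) (X i)) \<otimes>\<^bsub>Ab\<^esub>
      finprod Ab (\<lambda>k. cl (conj_pow (int k) (X i))) {..<p - 1} = \<one>\<^bsub>Ab\<^esub>"
    using finprod_conj_X[OF i] X by (simp add: conj_pow_in_K Pi_iff)
  then show ?thesis
    using X by (intro Ab.inv_equality[symmetric]) (auto simp: conj_pow_in_K intro!: Ab.finprod_closed)
qed

section \<open>Generators of the kernel\<close>

text \<open>The exponent runs through all integers, so that the set is stable under conjugation by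
  powers of \<open>x 1\<close>.\<close>

definition conj_gens where "conj_gens = {conj_pow j (val s) | j s. s \<in> gens}"

lemma conj_gens_in_K: "conj_gens \<subseteq> K"
  using val_in_K conj_pow_in_K by (auto simp: conj_gens_def)

lemma generate_conj_gens_in_K: "generate G conj_gens \<subseteq> K"
  by (rule generate_subgroup_incl[OF conj_gens_in_K K.subgroup_axioms])

lemma conj_pow_generate_conj_gens: "f \<in> generate G conj_gens \<Longrightarrow> conj_pow j f \<in> generate G conj_gens"
proof (induction rule: generate.induct)
  case one
  then show ?case by (simp add: generate.one)
next
  case (incl f)
  then have "conj_pow j f \<in> conj_gens"
    using val_closed conj_pow_conj_pow by (fastforce simp: conj_gens_def)
  then show ?case by (rule generate.incl)
next
  case (inv f)
  then have "conj_pow j f \<in> conj_gens"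
    using val_closed conj_pow_conj_pow by (fastforce simp: conj_gens_def)
  moreover have "f \<in> carrier G"
    using inv conj_gens_in_K K.subset by blast
  ultimately show ?case by (simp add: conj_pow_inv generate.inv)
next
  case (eng f g)
  then have "f \<in> carrier G" "g \<in> carrier G"
    using generate_conj_gens_in_K K.subset by blast+
  then show ?case using eng by (simp add: conj_pow_mult generate.eng)
qed

text \<open>Conjugation by powers of \<open>x 1\<close> preserves the first factor, so such a power
  can be moved to the right past an element of it.\<close>

lemma generate_conj_gens_times_powers:
  "subgroup {f \<otimes> x 1 [^] (j :: int) | f j. f \<in> generate G conj_gens} G" (is "subgroup ?W G")
proof (rule subgroupI)
  have P: "generate G conj_gens \<subseteq> carrier G"
    using generate_conj_gens_in_K K.subset by blast
  have sub: "subgroup (generate G conj_gens) G"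
    using generate_is_subgroup conj_gens_in_K K.subset by blast
  show "?W \<subseteq> carrier G"
    using P by auto
  show "?W \<noteq> {}"
    using generate.one by blast
  show "inv w \<in> ?W" if w: "w \<in> ?W" for w
  proof -
    obtain f and j :: int where fj: "w = f \<otimes> x 1 [^] j" "f \<in> generate G conj_gens"
      using w by blast
    have "inv w = x 1 [^] (- j) \<otimes> inv f"
      using fj P by (auto simp: inv_mult_group int_pow_neg)
    also have "\<dots> = conj_pow (- j) (inv f) \<otimes> x 1 [^] (- j)"
      using fj P by (intro conj_pow_pow[symmetric]) auto
    finally show ?thesis
      using fj subgroup.m_inv_closed[OF sub] conj_pow_generate_conj_gens by blast
  qed
  show "w \<otimes> w' \<in> ?W" if w: "w \<in> ?W" "w' \<in> ?W" for w w'
  proof -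
    obtain f g and i j :: int where w: "w = f \<otimes> x 1 [^] i" "f \<in> generate G conj_gens"
      "w' = g \<otimes> x 1 [^] j" "g \<in> generate G conj_gens"
      using w by blast
    then have fg: "f \<in> carrier G" "g \<in> carrier G"
      using P by auto
    have "w \<otimes> w' = f \<otimes> (x 1 [^] i \<otimes> g) \<otimes> x 1 [^] j"
      using w fg by (simp add: m_assoc)
    also have "\<dots> = (f \<otimes> conj_pow i g) \<otimes> x 1 [^] (i + j)"
      using fg by (simp add: conj_pow_pow[symmetric] int_pow_mult m_assoc)
    finally show ?thesis
      using w generate.eng[OF _ conj_pow_generate_conj_gens] by blast
  qed
qed

lemma K_generated: "K \<subseteq> generate G conj_gens"
proof -
  define W where "W = {f \<otimes> x 1 [^] (j :: int) | f j. f \<in> generate G conj_gens}"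
  have W: "subgroup W G"
    unfolding W_def by (rule generate_conj_gens_times_powers)
  interpret W: subgroup W G by fact
  have WI: "f \<otimes> x 1 [^] j \<in> W" if "f \<in> generate G conj_gens" for f and j :: int
    using that by (auto simp: W_def)
  have val_gen: "val s \<in> generate G conj_gens" if "s \<in> gens" for s
  proof -
    have "conj_pow 0 (val s) \<in> conj_gens"
      using that unfolding conj_gens_def by blast
    then show ?thesis
      using val_closed[OF that] by (simp add: generate.incl)
  qed
  have x1W: "x 1 \<in> W"
    using WI[OF generate.one, of 1] by simp
  have genW: "interp a b x s \<in> W" if s: "s \<in> fuchsian_gens g0 t" "s \<noteq> GX 2" for s
  proof -
    have ab: "interp a b x s \<in> W" if "s \<in> gens" "interp a b x s = val s"
      using WI[OF val_gen[OF that(1)], of 0] val_closed[OF that(1)] that(2) by simp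
    show ?thesis
    proof (cases s)
      case (GX i)
      then have "i \<in> {1..t}" "i \<noteq> 2"
        using s by (auto simp: fuchsian_gens_def)
      then consider "i = 1" | "i \<in> {3..t}"
        by fastforce
      then show ?thesis
      proof cases
        case 2
        then have "GX i \<in> gens" by (auto simp: gens_def)
        then show ?thesis
          using WI[OF val_gen, of "GX i" "m i"] X_mult[OF 2] GX by simp
      qed (use x1W GX in simp)
    qed (use s ab in \<open>auto simp: fuchsian_gens_def gens_def\<close>)
  qed
  \<comment> \<open>The long relator reads \<open>x 1\<close>, \<open>x 2\<close>, followed by a
    word \<open>w\<close> without \<open>GX 2\<close>, and can be solved for
    \<open>x 2\<close>.\<close>
  have x2W: "x 2 \<in> W" if t: "t \<ge> 2"
  proof -
    define w where "w = map (\<lambda>j. (GX j, True)) [3..<t + 1] @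
      concat (map (\<lambda>i. [(GA i, True), (GB i, True), (GA i, False), (GB i, False)]) [1..<g0 + 1])"
    have "w \<in> words (fuchsian_gens g0 t - {GX 2})"
      by (auto simp: w_def words_def fuchsian_gens_def)
    then have w: "word_val G (interp a b x) w \<in> W"
      by (rule word_val_in_subgroup[OF is_group W, rotated]) (use genW in auto)
    have x2: "x 2 \<in> carrier G"
      using x_closed[of 2] t by auto
    have "long_relator g0 t = [(GX 1, True), (GX 2, True)] @ w"
      unfolding long_relator_def upt_1_Suc[OF t] w_def by simp
    moreover have "word_val G (interp a b x) (long_relator g0 t) = \<one>"
      by (rule word_val_relator[OF pres]) (simp add: fuchsian_relators_def)
    ultimately have "x 1 \<otimes> (x 2 \<otimes> word_val G (interp a b x) w) = \<one>"
      by simp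
    then have "x 2 \<otimes> word_val G (interp a b x) w = inv (x 1)"
      using w x2 by (metis W.mem_carrier inv_equality inv_inv m_closed r_inv inv_unique' x1 inv_comm)
    then have "x 2 = inv (x 1) \<otimes> inv (word_val G (interp a b x) w)"
      using w x2 by (metis W.mem_carrier inv_closed inv_solve_right m_closed x1)
    then show ?thesis
      using x1W w by simp
  qed
  have "interp a b x ` fuchsian_gens g0 t \<subseteq> W"
  proof (intro image_subsetI)
    fix s assume s: "s \<in> fuchsian_gens g0 t"
    show "interp a b x s \<in> W"
    proof (cases "s = GX 2")
      case True
      then show ?thesis using s x2W by (auto simp: fuchsian_gens_def)
    qed (use s genW in auto)
  qed
  then have GW: "carrier G \<subseteq> W"
    using pres word_val_in_subgroup[OF is_group W, of "interp a b x"]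
    unfolding presentation_def by (metis image_subsetI)
  show ?thesis
  proof
    fix f assume f: "f \<in> K"
    then have "f \<in> W"
      using GW K.subset by blast
    then obtain g and j :: int where gj: "f = g \<otimes> x 1 [^] j" "g \<in> generate G conj_gens"
      unfolding W_def by blast
    then have "g \<in> K"
      using generate_conj_gens_in_K by blast
    then have g: "g \<in> carrier G" "\<phi> g = 0"
      by (simp_all add: K_iff)
    \<comment> \<open>Both \<open>f\<close> and \<open>g\<close> lie in the kernel, hence so does
      the power of \<open>x 1\<close>; as \<open>\<phi> (x 1)\<close> is a unit modulo
      \<open>p\<close>, this power is trivial.\<close>
    have "(j * \<phi> (x 1)) mod int p = 0"
      using f gj g phi_mult[of g "x 1 [^] j"] by (simp add: K_iff phi_pow_x1)
    then have "int p dvd j * \<phi> (x 1)"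
      by (simp add: dvd_eq_mod_eq_0)
    then have "int p dvd j"
      using coprime_phi_x[of 1] t_pos by (simp add: coprime_commute coprime_dvd_mult_left_iff)
    then have "x 1 [^] j = \<one>"
      using x1_pow_mod[of j] by simp
    then show "f \<in> generate G conj_gens"
      using gj g by simp
  qed
qed

section \<open>Generators of the abelianized kernel\<close>

lemma basis_index_iff:
  "(s, j) \<in> basis_index p g0 t \<longleftrightarrow>
    s \<in> gens \<and> j < p \<and> (\<forall>i. s = GX i \<longrightarrow> j < p - 1)"
  \<comment> \<open>With truncated subtraction, the bounds \<open>p - 1\<close> and
    \<open>p - 2\<close> become strict ones only because \<open>p \<ge> 2\<close>.\<close>
  using p_ge_2 by (auto simp: basis_index_def gens_def)

text \<open>Exponents may be reduced modulo \<open>p\<close>. The only conjugates then outside the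
  family are the last ones of the \<open>X i\<close>, which \<open>cl_conj_X_last\<close> expresses
  by the others.\<close>

lemma cl_conj_gens:
  assumes s: "s \<in> gens"
  shows "cl (conj_pow j (val s)) \<in> generate Ab (basis_family ` basis_index p g0 t)"
proof -
  define k where "k = nat (j mod int p)"
  have k: "int k = j mod int p" "k < p"
    using p_pos by (simp_all add: k_def nat_less_iff)
  have j: "conj_pow j (val s) = conj_pow (int k) (val s)"
    by (simp only: k conj_pow_mod)
  show ?thesis
  proof (cases "(s, k) \<in> basis_index p g0 t")
    case True
    then have "basis_family (s, k) \<in> generate Ab (basis_family ` basis_index p g0 t)"
      by (intro generate.incl imageI)
    then show ?thesis
      by (simp add: j basis_family_def)
  next
    case False
    then obtain i where i: "s = GX i" "k = p - 1"
      using s k by (auto simp: basis_index_iff)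
    then have i3: "i \<in> {3..t}"
      using s by (auto simp: gens_def)
    have sub: "subgroup (generate Ab (basis_family ` basis_index p g0 t)) Ab"
      by (rule Ab.generate_is_subgroup)
        (auto simp: basis_family_def basis_index_iff intro!: cl_closed conj_pow_in_K val_in_K)
    \<comment> \<open>The bound on \<open>r\<close> keeps every factor inside the family throughout
      the induction.\<close>
    have "finprod Ab (\<lambda>k. cl (conj_pow (int k) (X i))) {..<r} \<in> generate Ab (basis_family ` basis_index p g0 t)"
      if "r \<le> p - 1" for r
      using that
    proof (induction r)
      case 0
      then show ?case by (simp add: generate.one)
    next
      case (Suc r)
      have "(s, r) \<in> basis_index p g0 t"
        using Suc.prems s by (auto simp: basis_index_iff)
      then have "basis_family (s, r) \<in> generate Ab (basis_family ` basis_index p g0 t)"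
        by (intro generate.incl imageI)
      then have "cl (conj_pow (int r) (X i)) \<in> generate Ab (basis_family ` basis_index p g0 t)"
        by (simp add: basis_family_def i)
      moreover have "X i \<in> K"
        using val_in_K[OF s] i by simp
      ultimately show ?case
        using Suc by (simp add: lessThan_Suc generate.eng conj_pow_in_K Pi_iff)
    qed
    from this[of "p - 1"] show ?thesis
      using subgroup.m_inv_closed[OF sub] cl_conj_X_last[OF i3] unfolding j unfolding i by simp
  qed
qed

lemma basis_family_generates: "carrier Ab \<subseteq> generate Ab (basis_family ` basis_index p g0 t)"
proof -
  have closed: "basis_family ` basis_index p g0 t \<subseteq> carrier Ab"
    by (auto simp: basis_family_def basis_index_iff intro!: cl_closed conj_pow_in_K val_in_K)
  have "cl f \<in> generate Ab (basis_family ` basis_index p g0 t)" if "f \<in> generate G conj_gens" for f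
    using that
  proof (induction rule: generate.induct)
    case one
    then show ?case by (simp add: cl_one generate.one)
  next
    case (incl f)
    then show ?case using cl_conj_gens by (auto simp: conj_gens_def)
  next
    case (inv f)
    then have "cl f \<in> generate Ab (basis_family ` basis_index p g0 t)"
      using cl_conj_gens by (auto simp: conj_gens_def)
    moreover have "f \<in> K"
      using inv conj_gens_in_K by blast
    ultimately show ?case
      using Ab.generate_m_inv_closed[OF closed] by (simp add: cl_inv)
  next
    case (eng f g)
    then show ?case
      using generate_conj_gens_in_K by (auto simp: cl_mult subset_iff generate.eng)
  qed
  then show ?thesis
    using K_generated by (auto simp: carrier_Ab)
qed

section \<open>Dual functionals and independence\<close>

lemma residue_multiple_eq_iff:
  assumes "j < p" "k < p"
  shows "(int j * \<phi> (x 1)) mod int p = (int k * \<phi> (x 1)) mod int p \<longleftrightarrow> j = k"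
proof -
  have "inj_on (\<lambda>r. nat ((0 + int r * \<phi> (x 1)) mod int p)) {..<p}"
    using bij_betw_arith_progression[of "\<phi> (x 1)" p 0] coprime_phi_x[of 1] t_pos p_pos
    by (simp add: bij_betw_def)
  from inj_onD[OF this, of j k] show ?thesis
    using assms by auto
qed

text \<open>The functional evaluates at residue 0 a crossed homomorphism supported on the symbol
  \<open>s\<close> among those in \<open>gens\<close>. Conjugation by the \<open>j\<close>-th power
  of \<open>x 1\<close> moves the evaluation to the residue of \<open>j * \<phi> (x 1)\<close>, so
  an indicator at \<open>k * \<phi> (x 1)\<close> detects the exponent \<open>k\<close>.\<close>

lemma dual_functional:
  assumes s: "(s, k) \<in> basis_index p g0 t"
  shows "\<exists>\<psi>\<in>hom Ab integer_group. \<forall>i\<in>basis_index p g0 t. \<psi> (basis_family i) = of_bool ((s, k) = i)"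
proof -
  define ind :: "nat \<Rightarrow> int \<Rightarrow> int" where
    "ind j l = of_bool (l mod int p = (int j * \<phi> (x 1)) mod int p)" for j l
  \<comment> \<open>The coefficient at $h^{p-1}(X_i)$ is subtracted so that the sum of all $h^j(X_i)$ is killed.\<close>
  define d :: "gen \<Rightarrow> int \<Rightarrow> int" where
    "d s' l = (if s' = s then ind k l - (if \<exists>i. s = GX i then ind (p - 1) l else 0) else 0)" for s' l
  have ind_eq: "ind j (int l * \<phi> (x 1)) = of_bool (l = j)" if "j < p" "l < p" for j l
    unfolding ind_def residue_multiple_eq_iff[OF that(2,1)] ..
  have per: "mod_periodic p (d s')" for s'
    unfolding mod_periodic_def d_def ind_def by auto
  have d1: "d (GX 1) = (\<lambda>l. 0)"
    using s by (auto simp: d_def basis_index_iff gens_def)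
  have "(\<Sum>r<p. ind j (int r)) = 1" for j
    unfolding ind_def by (rule sum_residue_indicator[OF p_pos])
  then have "(\<Sum>r<p. d (GX j) (int r)) = 0" for j
    by (cases "GX j = s") (auto simp: d_def sum_subtractf)
  then obtain D where
    mult: "\<And>f g l. f \<in> carrier G \<Longrightarrow> g \<in> carrier G \<Longrightarrow> D (f \<otimes> g) l = D f l + D g (l + \<phi> f)"
    and D_per: "\<And>f. f \<in> carrier G \<Longrightarrow> mod_periodic p (D f)"
    and D_gen: "\<And>s. s \<in> fuchsian_gens g0 t \<Longrightarrow> s \<noteq> GX 2 \<Longrightarrow> D (interp a b x s) = d s"
    using fuchsian_crossed_hom[where d = d, OF prime pres hom phi_ab coprime_phi_x per d1] by blast
  have D_one: "D \<one> l = 0" for l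
    using mult[of \<one> \<one> l] phi_one by simp
  have D_inv: "D (inv f) l = - D f (l - \<phi> f)" if "f \<in> carrier G" for f l
    using mult[of f "inv f" "l - \<phi> f"] that D_one by simp
  have "GX 1 \<in> fuchsian_gens g0 t"
    using t_pos by (auto simp: fuchsian_gens_def)
  then have D_x1: "D (x 1) l = 0" for l
    using D_gen[of "GX 1"] d1 by simp
  have D_nat_pow: "D (x 1 [^] (n :: nat)) l = 0" for n l
    by (induction n arbitrary: l) (simp_all add: D_one D_x1 mult)
  have D_pow: "D (x 1 [^] (j :: int)) l = 0" for j l
  proof -
    have "D (inv (x 1 [^] n)) l = 0" for n :: nat
      by (subst D_inv) (simp_all add: D_nat_pow)
    then show ?thesis
      using D_nat_pow by (cases "j < 0") (simp_all only: int_pow_def2 if_True if_False)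
  qed
  \<comment> \<open>\<open>D\<close> vanishes on powers of \<open>x 1\<close>, so the left factor
    only translates the argument and the right factor contributes nothing.\<close>
  have D_cj: "D (conj_pow (int j) f) 0 = D f (int j * \<phi> (x 1))" if "f \<in> carrier G" for f j
  proof -
    have "D (conj_pow (int j) f) 0 = D f (\<phi> (x 1 [^] int j))"
      using that by (simp add: conj_pow_def mult D_pow D_inv)
    also have "\<dots> = D f (int j * \<phi> (x 1))"
      by (rule mod_periodicD[OF D_per[OF that]]) (simp only: phi_pow_x1 mod_mod_trivial)
    finally show ?thesis .
  qed
  have D_val: "D (val s') = d s'" if "s' \<in> gens" for s'
  proof (cases s')
    case (GX i)
    then have i: "i \<in> {3..t}"
      using that by (auto simp: gens_def)
    \<comment> \<open>\<open>X i\<close> and \<open>x i\<close> differ on the right by a power of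
      \<open>x 1\<close>, where \<open>D\<close> vanishes.\<close>
    then have "D (val s') l = D (x i) l" for l
      using X_def[OF i] x_closed[of i] GX by (simp add: mult D_inv D_pow)
    moreover have "D (x i) = d s'"
      using D_gen[of "GX i"] i GX by (simp add: fuchsian_gens_def image_iff)
    ultimately show ?thesis by auto
  qed (use D_gen[of s'] that in \<open>auto simp: gens_def fuchsian_gens_def\<close>)
  let ?H = "G\<lparr>carrier := K\<rparr>"
  \<comment> \<open>On \<open>K\<close> the translation by \<open>\<phi> f\<close> is trivial, so
    evaluation at 0 is additive. It kills the derived subgroup because the integers are commutative,
    and thus descends to \<open>Ab\<close>.\<close>
  have "(\<lambda>f. D f 0) \<in> hom ?H integer_group"
    by (rule homI) (use K_iff in \<open>auto simp: mult\<close>)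
  then interpret E: group_hom ?H integer_group "\<lambda>f. D f 0"
    using K.subgroup_is_group[OF is_group] by (simp add: group_hom_def group_hom_axioms_def)
  have "(\<lambda>f. D f 0) ` derived ?H K = {0}"
    using E.derived_img[of K] comm_group.derived_eq_singleton[OF abelian_integer_group] by simp
  then have "derived ?H K \<subseteq> kernel ?H integer_group (\<lambda>f. D f 0)"
    using normal_imp_subgroup[OF derived_normal] by (auto simp: kernel_def dest: subgroup.mem_carrier)
  then obtain \<psi> where \<psi>: "\<psi> \<in> hom Ab integer_group" "\<And>f. f \<in> K \<Longrightarrow> \<psi> (cl f) = D f 0"
    using E.FactGroup_universal_kernel[OF derived_normal] by (auto simp: Ab_def cl_def)
  have "\<psi> (basis_family (s', j)) = of_bool ((s, k) = (s', j))" if i: "(s', j) \<in> basis_index p g0 t" for s' j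
  proof -
    have s': "s' \<in> gens" "j < p" "\<And>i. s' = GX i \<Longrightarrow> j < p - 1"
      and k: "k < p"
      using i s by (auto simp: basis_index_iff)
    have "\<psi> (basis_family (s', j)) = d s' (int j * \<phi> (x 1))"
      using s' by (simp add: basis_family_def \<psi>(2) conj_pow_in_K val_in_K val_closed D_cj D_val)
    \<comment> \<open>For a symbol \<open>GX i\<close> the index satisfies \<open>j < p - 1\<close>,
      so the subtracted indicator is 0 there.\<close>
    also have "\<dots> = of_bool ((s, k) = (s', j))"
      using s' k p_pos by (auto simp: d_def ind_eq)
    finally show ?thesis .
  qed
  from this[of "fst i" "snd i" for i] show ?thesis
    by (intro bexI[OF _ \<psi>(1)] ballI) simp
qed

lemma basis_family_basis:
  "inj_on basis_family (basis_index p g0 t) \<and> Z_basis Ab (basis_family ` basis_index p g0 t)"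
proof (rule Z_basis_of_dual_family[OF Ab.comm_group_axioms _ basis_family_generates])
  show "basis_family ` basis_index p g0 t \<subseteq> carrier Ab"
    by (auto simp: basis_family_def basis_index_iff intro!: cl_closed conj_pow_in_K val_in_K)
  show "\<exists>\<psi>\<in>hom Ab integer_group. \<forall>j\<in>basis_index p g0 t. \<psi> (basis_family j) = of_bool (i = j)"
    if "i \<in> basis_index p g0 t" for i
    using dual_functional[of "fst i" "snd i"] that by simp
qed

section \<open>Adaptedness\<close>

text \<open>The class of \<open>val s\<close> serves as \<open>\<gamma>\<close> for every index
  \<open>(s, k)\<close>, since its iterates under \<open>\<alpha>\<close> are the classes with
  symbol \<open>s\<close>. Only the effect of \<open>\<alpha>\<close> on classes enters, so no
  geometry is involved.\<close>

lemma basis_family_adapted: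
  assumes \<alpha>: "\<And>f. f \<in> K \<Longrightarrow> \<alpha> (cl f) = cl (conj_pow 1 f)"
    and \<gamma>0: "\<gamma>0 \<in> basis_family ` basis_index p g0 t"
  shows "\<exists>\<gamma>\<in>carrier Ab. (\<exists>k. \<gamma>0 = (\<alpha> ^^ k) \<gamma> \<or> \<gamma> = (\<alpha> ^^ k) \<gamma>0) \<and>
    ((\<forall>j<p. (\<alpha> ^^ j) \<gamma> \<in> basis_family ` basis_index p g0 t) \<or>
     (\<forall>j<p - 1. (\<alpha> ^^ j) \<gamma> \<in> basis_family ` basis_index p g0 t) \<and>
     (\<alpha> ^^ (p - 1)) \<gamma> = inv\<^bsub>Ab\<^esub> (finprod Ab (\<lambda>j. (\<alpha> ^^ j) \<gamma>) {..<p - 1}))"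
proof -
  obtain s k where s: "\<gamma>0 = basis_family (s, k)" "(s, k) \<in> basis_index p g0 t"
    using \<gamma>0 by auto
  then have sg: "s \<in> gens"
    by (simp add: basis_index_iff)
  have pow: "(\<alpha> ^^ j) (cl (val s)) = basis_family (s, j)" for j
  proof (induction j)
    case 0
    then show ?case using val_closed[OF sg] by (simp add: basis_family_def)
  next
    case (Suc j)
    then show ?case
      using val_closed[OF sg] val_in_K[OF sg] by (simp add: basis_family_def \<alpha> conj_pow_in_K conj_pow_conj_pow)
  qed
  show ?thesis
  proof (intro bexI[of _ "cl (val s)"] conjI)
    show "\<exists>k. \<gamma>0 = (\<alpha> ^^ k) (cl (val s)) \<or> cl (val s) = (\<alpha> ^^ k) \<gamma>0"
      using s pow by metis
    show "(\<forall>j<p. (\<alpha> ^^ j) (cl (val s)) \<in> basis_family ` basis_index p g0 t) \<or>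
     (\<forall>j<p - 1. (\<alpha> ^^ j) (cl (val s)) \<in> basis_family ` basis_index p g0 t) \<and>
     (\<alpha> ^^ (p - 1)) (cl (val s)) =
       inv\<^bsub>Ab\<^esub> (finprod Ab (\<lambda>j. (\<alpha> ^^ j) (cl (val s))) {..<p - 1})"
    proof (cases "\<exists>i. s = GX i")
      case True
      then obtain i where i: "s = GX i" "i \<in> {3..t}"
        using sg by (auto simp: gens_def)
      have "\<forall>j<p - 1. basis_family (s, j) \<in> basis_family ` basis_index p g0 t"
        using sg by (auto simp: basis_index_iff)
      moreover have "basis_family (s, p - 1) = inv\<^bsub>Ab\<^esub> (finprod Ab (\<lambda>j. basis_family (s, j)) {..<p - 1})"
        using cl_conj_X_last[OF i(2)] by (simp add: basis_family_def i)
      ultimately show ?thesis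
        unfolding pow by blast
    next
      case False
      then have "\<forall>j<p. basis_family (s, j) \<in> basis_family ` basis_index p g0 t"
        using sg by (auto simp: basis_index_iff)
      then show ?thesis
        unfolding pow by blast
    qed
    show "cl (val s) \<in> carrier Ab"
      using val_in_K[OF sg] by simp
  qed
qed

end

section \<open>Lifts to the half plane and their action on homology\<close>

lemma moebius_denom_nonzero:
  assumes "det (M :: real^2^2) = 1" "z \<in> upper_half_plane"
  shows "of_real (M$2$1) * z + of_real (M$2$2) \<noteq> 0"
proof
  assume 0: "of_real (M$2$1) * z + of_real (M$2$2) = 0"
  then have "Im (of_real (M$2$1) * z + of_real (M$2$2)) = 0"
    by simp
  then have "M$2$1 = 0"
    using assms(2) by (simp add: upper_half_plane_def)
  with 0 have "M$2$2 = 0" by simp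
  with \<open>M$2$1 = 0\<close> assms(1) show False
    by (simp add: det_2)
qed

lemma moebius_UHP_apply:
  "z \<in> upper_half_plane \<Longrightarrow> moebius_UHP M z =
    (of_real (M$1$1) * z + of_real (M$1$2)) / (of_real (M$2$1) * z + of_real (M$2$2))"
  by (simp add: moebius_UHP_def moebius_def)

text \<open>The transformation multiplies the imaginary part by \<open>det M\<close> over the
  squared modulus of the denominator.\<close>

lemma moebius_UHP_in_UHP:
  assumes M: "det (M :: real^2^2) = 1" and z: "z \<in> upper_half_plane"
  shows "moebius_UHP M z \<in> upper_half_plane"
proof -
  let ?c = "of_real (M$2$1) * z + of_real (M$2$2) :: complex"
  let ?n = "of_real (M$1$1) * z + of_real (M$1$2) :: complex"
  have "Im (?n / ?c) = Im (?n * cnj ?c) / (cmod ?c)\<^sup>2"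
    by (simp add: complex_div_cnj[of ?n])
  also have "Im (?n * cnj ?c) = det M * Im z"
    by (simp add: det_2 algebra_simps)
  finally have "Im (?n / ?c) = Im z / (cmod ?c)\<^sup>2"
    using M by simp
  moreover have "(cmod ?c)\<^sup>2 > 0"
    using moebius_denom_nonzero[OF M z] by simp
  ultimately show ?thesis
    using z moebius_UHP_apply[OF z, of M] by (simp add: upper_half_plane_def)
qed

lemma moebius_UHP_compose:
  assumes M: "det (M :: real^2^2) = 1" and N: "det (N :: real^2^2) = 1"
    and z: "z \<in> upper_half_plane"
  shows "moebius_UHP M (moebius_UHP N z) = moebius_UHP (M ** N) z"
proof -
  have w: "moebius_UHP N z \<in> upper_half_plane"
    by (rule moebius_UHP_in_UHP[OF N z])
  let ?c = "of_real (N$2$1) * z + of_real (N$2$2) :: complex"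
  let ?n = "of_real (N$1$1) * z + of_real (N$1$2) :: complex"
  have c: "?c \<noteq> 0"
    by (rule moebius_denom_nonzero[OF N z])
  have "moebius_UHP M (moebius_UHP N z) =
      (of_real (M$1$1) * (?n / ?c) + of_real (M$1$2)) /
      (of_real (M$2$1) * (?n / ?c) + of_real (M$2$2))"
    using moebius_UHP_apply[OF w, of M] moebius_UHP_apply[OF z, of N] by simp
  also have "\<dots> = ((of_real (M$1$1) * (?n / ?c) + of_real (M$1$2)) * ?c) /
      ((of_real (M$2$1) * (?n / ?c) + of_real (M$2$2)) * ?c)"
    using c by simp
  also have "\<dots> = (of_real (M$1$1) * ?n + of_real (M$1$2) * ?c) /
      (of_real (M$2$1) * ?n + of_real (M$2$2) * ?c)"
    using c by (simp only: distrib_right mult.assoc) simp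
  also have "\<dots> = moebius_UHP (M ** N) z"
    by (simp add: moebius_UHP_apply[OF z] matrix_matrix_mult_def sum_2 algebra_simps)
  finally show ?thesis .
qed

lemma moebius_UHP_one: "z \<in> upper_half_plane \<Longrightarrow> moebius_UHP (mat 1) z = z"
  by (simp add: moebius_UHP_apply mat_def)

lemma moebius_UHP_in_Bij:
  assumes M: "det (M :: real^2^2) = 1"
  shows "moebius_UHP M \<in> Bij upper_half_plane"
proof -
  have "invertible M"
    using M by (simp add: invertible_det_nz)
  then obtain N where N: "M ** N = mat 1" "N ** M = mat 1"
    unfolding invertible_def by blast
  then have dN: "det N = 1"
    using M det_mul[of M N] by simp
  have "bij_betw (moebius_UHP M) upper_half_plane upper_half_plane"
    by (rule bij_betw_byWitness[of _ "moebius_UHP N"])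
      (use M dN N in \<open>auto simp: moebius_UHP_compose moebius_UHP_one moebius_UHP_in_UHP\<close>)
  then show ?thesis
    by (simp add: Bij_def moebius_UHP_def)
qed

lemma PSL2R_mult_apply:
  assumes "f \<in> carrier PSL2R" "g \<in> carrier PSL2R" "z \<in> upper_half_plane"
  shows "(f \<otimes>\<^bsub>PSL2R\<^esub> g) z = f (g z)"
  using assms moebius_UHP_in_Bij by (auto simp: PSL2R_def BijGroup_def compose_def)

text \<open>\<open>PSL2R\<close> is \<open>BijGroup\<close> with a smaller carrier, so the point is
  closure of that carrier, which matrix products and inverse matrices provide.\<close>

lemma group_PSL2R: "group PSL2R"
proof -
  have "subgroup {moebius_UHP M |M. det M = 1} (BijGroup upper_half_plane)"
  proof (rule group.subgroupI[OF group_BijGroup])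
    show "{moebius_UHP M |M. det M = 1} \<subseteq> carrier (BijGroup upper_half_plane)"
      using moebius_UHP_in_Bij by (auto simp: BijGroup_def)
    show "{moebius_UHP M |M. det M = 1} \<noteq> {}"
      by (auto intro!: exI[of _ "mat 1"])
  next
    fix f g assume "f \<in> {moebius_UHP M |M. det M = 1}" "g \<in> {moebius_UHP M |M. det M = 1}"
    then obtain M N where MN: "f = moebius_UHP M" "g = moebius_UHP N" "det M = 1" "det N = 1"
      by blast
    have "compose upper_half_plane f g = moebius_UHP (M ** N)"
    proof
      fix z show "compose upper_half_plane f g z = moebius_UHP (M ** N) z"
        using MN by (cases "z \<in> upper_half_plane")
          (simp_all add: compose_def moebius_UHP_compose, simp add: moebius_UHP_def)
    qed
    then show "f \<otimes>\<^bsub>BijGroup upper_half_plane\<^esub> g \<in> {moebius_UHP M |M. det M = 1}"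
      using MN moebius_UHP_in_Bij by (auto simp: BijGroup_def det_mul intro!: exI[of _ "M ** N"])
  next
    fix f assume "f \<in> {moebius_UHP M |M. det M = 1}"
    then obtain M where M: "f = moebius_UHP M" "det M = 1"
      by blast
    then have "invertible M"
      by (simp add: invertible_det_nz)
    then obtain N where N: "M ** N = mat 1" "N ** M = mat 1"
      unfolding invertible_def by blast
    then have dN: "det N = 1"
      using M det_mul[of M N] by simp
    have "compose upper_half_plane (moebius_UHP N) f = (\<lambda>z\<in>upper_half_plane. z)"
      using M dN N by (auto simp: compose_def fun_eq_iff moebius_UHP_compose moebius_UHP_one)
    then have "moebius_UHP N \<otimes>\<^bsub>BijGroup upper_half_plane\<^esub> f = \<one>\<^bsub>BijGroup upper_half_plane\<^esub>"
      using M dN moebius_UHP_in_Bij by (simp add: BijGroup_def)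
    then have "inv\<^bsub>BijGroup upper_half_plane\<^esub> f = moebius_UHP N"
      using M dN moebius_UHP_in_Bij
      by (intro group.inv_equality[OF group_BijGroup]) (auto simp: BijGroup_def)
    then show "inv\<^bsub>BijGroup upper_half_plane\<^esub> f \<in> {moebius_UHP M |M. det M = 1}"
      using dN by blast
  qed
  then show ?thesis
    unfolding PSL2R_def by (rule subgroup.subgroup_is_group[OF _ group_BijGroup])
qed

section \<open>Comparison of two lifts\<close>

text \<open>Clearing denominators turns coincidence at a point into a root of a polynomial of degree
  at most 2; infinitely many roots make it the zero polynomial.\<close>

lemma infinite_coincidence_imp_eq:
  assumes f: "f \<in> carrier PSL2R" and g: "g \<in> carrier PSL2R"
    and inf: "infinite {z \<in> upper_half_plane. f z = g z}"
  shows "f = g"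
proof -
  obtain M N where MN: "f = moebius_UHP M" "g = moebius_UHP N" "det M = 1" "det N = 1"
    using f g by (auto simp: PSL2R_def)
  define P :: "complex poly" where
    "P = [:of_real (M$1$2), of_real (M$1$1):] * [:of_real (N$2$2), of_real (N$2$1):] -
         [:of_real (N$1$2), of_real (N$1$1):] * [:of_real (M$2$2), of_real (M$2$1):]"
  have eq: "f z = g z \<longleftrightarrow> poly P z = 0" if z: "z \<in> upper_half_plane" for z
    using moebius_denom_nonzero[OF MN(3) z] moebius_denom_nonzero[OF MN(4) z]
    by (simp add: MN(1,2) moebius_UHP_apply[OF z] P_def frac_eq_eq algebra_simps)
  have "{z \<in> upper_half_plane. f z = g z} \<subseteq> {z. poly P z = 0}"
    using eq by auto
  then have "infinite {z. poly P z = 0}"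
    using inf finite_subset by blast
  then have "P = 0"
    using poly_roots_finite by blast
  then have "f z = g z" if "z \<in> upper_half_plane" for z
    using eq[OF that] by simp
  then show ?thesis
    by (auto simp: fun_eq_iff MN moebius_UHP_def)
qed

text \<open>At each point some element of \<open>F\<close> carries one lift to the other. Since \<open>F\<close> is countable, a
  single element does so on an uncountable set, hence everywhere.\<close>
lemma lifts_differ_by_element:
  assumes F: "subgroup F PSL2R" "countable F"
    and T: "T \<in> carrier PSL2R" "T' \<in> carrier PSL2R"
    and orb: "\<And>z. z \<in> upper_half_plane \<Longrightarrow> orbit F (T z) = orbit F (T' z)"
  obtains f where "f \<in> F" "T' = f \<otimes>\<^bsub>PSL2R\<^esub> T"
proof -
  interpret PSL: group PSL2R by (rule group_PSL2R)
  interpret F: subgroup F PSL2R by fact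
  have cover: "upper_half_plane \<subseteq> (\<Union>f\<in>F. {z \<in> upper_half_plane. T' z = (f \<otimes>\<^bsub>PSL2R\<^esub> T) z})"
  proof
    fix z assume z: "z \<in> upper_half_plane"
    have "T' z \<in> upper_half_plane"
      using T(2) moebius_UHP_in_UHP[OF _ z] by (auto simp: PSL2R_def)
    then have "\<one>\<^bsub>PSL2R\<^esub> (T' z) = T' z"
      by (simp add: PSL2R_def BijGroup_def)
    then have "T' z \<in> orbit F (T' z)"
      unfolding orbit_def using F.one_closed by (metis (mono_tags, lifting) mem_Collect_eq)
    then obtain f where f: "f \<in> F" "T' z = f (T z)"
      using orb[OF z] unfolding orbit_def by blast
    then show "z \<in> (\<Union>f\<in>F. {z \<in> upper_half_plane. T' z = (f \<otimes>\<^bsub>PSL2R\<^esub> T) z})"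
      using z T PSL2R_mult_apply[OF _ T(1) z] F.mem_carrier by auto
  qed
  have "\<exists>f\<in>F. infinite {z \<in> upper_half_plane. T' z = (f \<otimes>\<^bsub>PSL2R\<^esub> T) z}"
  proof (rule ccontr)
    assume "\<not> ?thesis"
    then have "countable (\<Union>f\<in>F. {z \<in> upper_half_plane. T' z = (f \<otimes>\<^bsub>PSL2R\<^esub> T) z})"
      using F(2) by (intro countable_UN) (auto intro: countable_finite)
    then show False
      using cover uncountable_halfspace_Im_gt[of 0] countable_subset
      unfolding upper_half_plane_def by blast
  qed
  then obtain f where f: "f \<in> F" "infinite {z \<in> upper_half_plane. T' z = (f \<otimes>\<^bsub>PSL2R\<^esub> T) z}"
    by blast
  then have "T' = f \<otimes>\<^bsub>PSL2R\<^esub> T"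
    using T by (intro infinite_coincidence_imp_eq) auto
  with f(1) that show thesis by blast
qed

section \<open>The induced action on homology\<close>

text \<open>A surjective endomorphism maps the derived subgroup into itself and so acts on classes.
  This gives independence of the representative.\<close>

lemma derived_coset_hom_cong:
  assumes "group H" and c: "c \<in> hom H H" "c ` carrier H = carrier H"
    and f: "f \<in> carrier H" and f': "f' \<in> derived H (carrier H) #>\<^bsub>H\<^esub> f"
  shows "derived H (carrier H) #>\<^bsub>H\<^esub> c f' = derived H (carrier H) #>\<^bsub>H\<^esub> c f"
proof -
  interpret H: group H by fact
  interpret c: group_hom H H c
    using c by (simp add: group_hom_def group_hom_axioms_def assms(1))
  have N: "subgroup (derived H (carrier H)) H"
    by (rule H.derived_is_subgroup) simp
  have NH: "derived H (carrier H) \<subseteq> carrier H"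
    by (rule H.derived_in_carrier) simp
  obtain k where k: "k \<in> derived H (carrier H)" "f' = k \<otimes>\<^bsub>H\<^esub> f"
    using f' by (auto simp: r_coset_def)
  then have kH: "k \<in> carrier H" using NH by blast
  have "c k \<in> derived H (carrier H)"
    using c.derived_img[of "carrier H"] c(2) k(1) by auto
  then have "derived H (carrier H) #>\<^bsub>H\<^esub> c k = derived H (carrier H)"
    using N kH by (intro H.coset_join2) auto
  then show ?thesis
    using k(2) kH f NH H.coset_mult_assoc[of "derived H (carrier H)" "c k" "c f"] by simp
qed

text \<open>Inner automorphisms act trivially on the commutative quotient. This gives independence
  of the lift.\<close>

lemma derived_coset_conj:
  assumes "group H" "g \<in> carrier H" "f \<in> carrier H"
  shows "derived H (carrier H) #>\<^bsub>H\<^esub> (g \<otimes>\<^bsub>H\<^esub> f \<otimes>\<^bsub>H\<^esub> inv\<^bsub>H\<^esub> g) = derived H (carrier H) #>\<^bsub>H\<^esub> f"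
proof -
  interpret H: group H by fact
  let ?N = "derived H (carrier H)"
  interpret Q: comm_group "H Mod ?N"
    by (rule H.derived_quot_is_comm_group)
  interpret q: group_hom H "H Mod ?N" "\<lambda>f. ?N #>\<^bsub>H\<^esub> f"
    using normal.r_coset_hom_Mod[OF H.derived_self_is_normal]
    by (simp add: group_hom_def group_hom_axioms_def assms(1) Q.is_group)
  define q where "q f = ?N #>\<^bsub>H\<^esub> f" for f
  have q: "q f \<in> carrier (H Mod ?N)" "q g \<in> carrier (H Mod ?N)"
    unfolding q_def using assms q.hom_closed by blast+
  have "q (g \<otimes>\<^bsub>H\<^esub> f \<otimes>\<^bsub>H\<^esub> inv\<^bsub>H\<^esub> g) =
      q g \<otimes>\<^bsub>H Mod ?N\<^esub> q f \<otimes>\<^bsub>H Mod ?N\<^esub> inv\<^bsub>H Mod ?N\<^esub> (q g)"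
    unfolding q_def using assms by (simp only: q.hom_mult q.hom_inv H.m_closed H.inv_closed)
  also have "\<dots> = q f \<otimes>\<^bsub>H Mod ?N\<^esub> (q g \<otimes>\<^bsub>H Mod ?N\<^esub> inv\<^bsub>H Mod ?N\<^esub> (q g))"
    using q by (simp only: Q.m_assoc Q.m_comm[of "q g" "q f"] Q.inv_closed)
  also have "\<dots> = q f"
    using q by (simp only: Q.r_inv Q.r_one)
  finally show ?thesis
    by (simp only: q_def)
qed

text \<open>\<open>homology_action\<close> is a definite description over all lifts and
  representatives, so every choice must be shown to give the same class. A change of lift is
  conjugation by an element of \<open>F\<close>; a change of representative is multiplication by a
  derived element.\<close>

lemma homology_action_hclass:
  assumes F: "subgroup F PSL2R" "countable F" and T: "lifts_to F T h" and f: "f \<in> F"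
  shows "homology_action F h (hclass F f) = hclass F (conj_by T f)"
  unfolding homology_action_def
proof (rule the_equality)
  interpret PSL: group PSL2R by (rule group_PSL2R)
  interpret F: subgroup F PSL2R by fact
  let ?H = "subgroup_of_PSL2R F"
  have H: "group ?H"
    by (rule F.subgroup_is_group) (rule PSL.is_group)
  have self: "f \<in> hclass F f"
    unfolding hclass_def
    by (rule group.rcos_self[OF H]) (use f group.derived_is_subgroup[OF H, of F] in auto)
  then show "\<exists>T' f'. lifts_to F T' h \<and> f' \<in> hclass F f \<and>
      hclass F (conj_by T f) = hclass F (conj_by T' f')"
    using T by blast
  fix d assume "\<exists>T' f'. lifts_to F T' h \<and> f' \<in> hclass F f \<and> d = hclass F (conj_by T' f')"
  then obtain T' f' where T': "lifts_to F T' h" and f': "f' \<in> hclass F f"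
    and d: "d = hclass F (conj_by T' f')"
    by blast
  have TT: "T \<in> carrier PSL2R" "T' \<in> carrier PSL2R"
    using T T' by (auto simp: lifts_to_def)
  have "orbit F (T z) = orbit F (T' z)" if "z \<in> upper_half_plane" for z
    using T T' that unfolding lifts_to_def by metis
  then obtain g where g: "g \<in> F" "T' = g \<otimes>\<^bsub>PSL2R\<^esub> T"
    using lifts_differ_by_element[OF F TT] by blast
  have "hclass F f \<subseteq> F"
    unfolding hclass_def
    using monoid.r_coset_subset_G[OF group.is_monoid[OF H], of "derived ?H F" f] group.derived_in_carrier[OF H, of F] f
    by simp
  then have f'F: "f' \<in> F"
    using f' by blast
  have img: "conj_by T ` F = F"
    using T by (simp add: lifts_to_def)
  have y: "conj_by T f' \<in> F" "conj_by T f' \<in> carrier PSL2R"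
    using img f'F F.subset by blast+
  have "conj_by T' f' = g \<otimes>\<^bsub>PSL2R\<^esub> conj_by T f' \<otimes>\<^bsub>PSL2R\<^esub> inv\<^bsub>PSL2R\<^esub> g"
    using g TT F.subset f'F by (auto simp: conj_by_def PSL.m_assoc PSL.inv_mult_group subset_iff)
  also have "\<dots> = g \<otimes>\<^bsub>?H\<^esub> conj_by T f' \<otimes>\<^bsub>?H\<^esub> inv\<^bsub>?H\<^esub> g"
    using g F by simp
  finally have "hclass F (conj_by T' f') = hclass F (conj_by T f')"
    unfolding hclass_def using derived_coset_conj[OF H, of g "conj_by T f'"] g y by simp
  moreover have "conj_by T \<in> hom ?H ?H"
  proof (rule homI)
    show "conj_by T k \<in> carrier ?H" if "k \<in> carrier ?H" for k
      using that img by auto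
    show "conj_by T (k \<otimes>\<^bsub>?H\<^esub> l) = conj_by T k \<otimes>\<^bsub>?H\<^esub> conj_by T l"
      if "k \<in> carrier ?H" "l \<in> carrier ?H" for k l
    proof -
      have kl: "k \<in> carrier PSL2R" "l \<in> carrier PSL2R"
        using that F.subset by auto
      have "inv\<^bsub>PSL2R\<^esub> T \<otimes>\<^bsub>PSL2R\<^esub> (T \<otimes>\<^bsub>PSL2R\<^esub> z) = z" if "z \<in> carrier PSL2R" for z
        using that TT by (simp add: PSL.m_assoc[symmetric])
      then show ?thesis
        using kl TT by (simp add: conj_by_def PSL.m_assoc)
    qed
  qed
  then have "hclass F (conj_by T f') = hclass F (conj_by T f)"
    using derived_coset_hom_cong[OF H, of "conj_by T" f f'] img f f' by (simp add: hclass_def)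
  ultimately show "d = hclass F (conj_by T f)"
    by (simp add: d)
qed

section \<open>Transfer to the Fuchsian group\<close>

text \<open>Provides the countability of \<open>F0\<close>, hence of \<open>F\<close>, on which the
  comparison of lifts rests.\<close>

lemma countable_presented:
  assumes "presentation G Y R v" "countable Y"
  shows "countable (carrier G)"
proof -
  have "countable (words Y)"
    unfolding words_def using assms(2) by (intro countable_lists) auto
  then have "countable (word_val G v ` words Y)"
    by (rule countable_image)
  then show ?thesis
    using assms(1) by (simp add: presentation_def)
qed

theorem corollary7p3:
  fixes p g0 t g :: nat
    and F0 F :: "(complex \<Rightarrow> complex) set"
    and a b x Ai Bi Xi xbar :: "nat \<Rightarrow> complex \<Rightarrow> complex"
    and \<phi> :: "(complex \<Rightarrow> complex) \<Rightarrow> int"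
    and n :: "nat \<Rightarrow> int"
    and h :: "complex set \<Rightarrow> complex set"
    and family :: "gen \<times> nat \<Rightarrow> (complex \<Rightarrow> complex) set"
  assumes "prime p" and "p \<ge> 2" and "t > 0"
    and "fuchsian_group F0"
    and "presentation (subgroup_of_PSL2R F0) (fuchsian_gens g0 t) (fuchsian_relators p g0 t)
           (interp a b x)"
    and "\<phi> \<in> epi (subgroup_of_PSL2R F0) (integer_mod_group p)"
    and "\<And>i. i \<in> {1..g0} \<Longrightarrow> \<phi> (a i) = 0 \<and> \<phi> (b i) = 0"
    and "\<And>j. j \<in> {1..t} \<Longrightarrow> \<phi> (x j) = n j \<and> n j \<noteq> 0"
    and "F = kernel (subgroup_of_PSL2R F0) (integer_mod_group p) \<phi>"
    and "compact_space (orbit_surface F)" and "has_genus (orbit_surface F) g" and "g \<ge> 2"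
    and "\<And>z. z \<in> upper_half_plane \<Longrightarrow> h (orbit F z) = orbit F (x 1 z)"
    and "\<And>i. i \<in> {1..g0} \<Longrightarrow> Ai i = a i \<and> Bi i = b i"
    and "\<And>i. i \<in> {3..t} \<Longrightarrow> (\<exists>k :: int. xbar i = x 1 [^]\<^bsub>PSL2R\<^esub> k) \<and> \<phi> (xbar i) = \<phi> (x i)"
    and "\<And>i. i \<in> {3..t} \<Longrightarrow> Xi i = x i \<otimes>\<^bsub>PSL2R\<^esub> inv\<^bsub>PSL2R\<^esub> (xbar i)"
    and "\<And>s j. family (s, j) = hclass F (conj_by (x 1 [^]\<^bsub>PSL2R\<^esub> j) (interp Ai Bi Xi s))"
  shows "inj_on family (basis_index p g0 t) \<and>
         homology_basis F (family ` basis_index p g0 t) \<and>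
         adapted p F h (family ` basis_index p g0 t)"
proof -
  let ?G = "subgroup_of_PSL2R F0"
  interpret PSL: group PSL2R by (rule group_PSL2R)
  have F0: "subgroup F0 PSL2R"
    using assms(4) by (simp add: fuchsian_group_def)
  interpret F0: subgroup F0 PSL2R by fact
  have "GX 1 \<in> fuchsian_gens g0 t"
    using assms(3) by (auto simp: fuchsian_gens_def)
  then have x1: "x 1 \<in> F0"
    using assms(5) unfolding presentation_def by force
  \<comment> \<open>The locale computes in \<open>F0\<close>, the statement in \<open>PSL2R\<close>;
    powers agree because \<open>F0\<close> is a subgroup.\<close>
  have int_pow: "x 1 [^]\<^bsub>?G\<^esub> k = x 1 [^]\<^bsub>PSL2R\<^esub> k" for k :: int
    by (rule PSL.int_pow_consistent[OF F0 x1, symmetric])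
  have pow_F0: "x 1 [^]\<^bsub>PSL2R\<^esub> k \<in> F0" for k :: int
    by (rule PSL.subgroup_int_pow_closed[OF F0 x1])
  obtain m :: "nat \<Rightarrow> int" where m: "\<And>i. i \<in> {3..t} \<Longrightarrow> xbar i = x 1 [^]\<^bsub>PSL2R\<^esub> m i"
    using assms(15) by metis
  interpret C: cyclic_cover ?G p g0 t a b x Xi m \<phi>
  proof
    show "\<phi> \<in> hom ?G (integer_mod_group p)"
      using assms(6) by (simp add: epi_def)
    show "\<phi> (x 1 [^]\<^bsub>?G\<^esub> m i) = \<phi> (x i)" if "i \<in> {3..t}" for i
      using assms(15)[OF that] m[OF that] by (simp only: int_pow)
    show "Xi i = x i \<otimes>\<^bsub>?G\<^esub> inv\<^bsub>?G\<^esub> (x 1 [^]\<^bsub>?G\<^esub> m i)" if "i \<in> {3..t}" for i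
      using assms(16)[OF that] m[OF that] PSL.m_inv_consistent[OF F0 pow_F0]
      by (simp add: int_pow del: One_nat_def)
  qed (use assms in auto)
  have K: "C.K = F"
    using assms(9) by (simp add: C.K_def)
  have Ab: "C.Ab = H1 F"
    by (simp add: C.Ab_def H1_def K)
  have cl: "C.cl f = hclass F f" for f
    by (simp add: C.cl_def hclass_def K)
  have cj: "C.conj_pow k f = conj_by (x 1 [^]\<^bsub>PSL2R\<^esub> k) f" for k f
    using PSL.m_inv_consistent[OF F0 pow_F0, of k] by (simp add: C.conj_pow_def conj_by_def int_pow)
  \<comment> \<open>The equality is restricted to the index set, as \<open>Ai\<close> and
    \<open>Bi\<close> agree with \<open>a\<close> and \<open>b\<close> only on
    \<open>{1..g0}\<close>.\<close>
  have family: "family i = C.basis_family i" if i: "i \<in> basis_index p g0 t" for i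
  proof -
    obtain s j where sj: "i = (s, j)" by force
    then have "interp Ai Bi Xi s = interp a b Xi s"
      using i assms(14) by (auto simp: basis_index_def)
    then show ?thesis
      by (simp add: sj C.basis_family_def assms(17) cl cj int_pow_int)
  qed
  have image: "family ` basis_index p g0 t = C.basis_family ` basis_index p g0 t"
    using family by (rule image_cong[OF HOL.refl])
  have F: "subgroup F PSL2R"
    using PSL.incl_subgroup[OF F0] C.K.subgroup_axioms by (simp add: K)
  have "countable F0"
    using countable_presented[OF assms(5)] by (simp add: fuchsian_gens_def countable_finite)
  then have "countable F"
    using C.K.subset K countable_subset by fastforce
  have "lifts_to F (x 1) h"
    unfolding lifts_to_def
  proof (intro conjI ballI assms(13))
    show "x 1 \<in> carrier PSL2R"
      using x1 F0.subset by blast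
    have cj1: "C.conj_pow 1 f = conj_by (x 1) f" for f
      using x1 F0.subset by (simp add: cj subset_iff)
    show "conj_by (x 1) ` F = F"
    proof
      show "conj_by (x 1) ` F \<subseteq> F"
        using C.conj_pow_in_K[of _ 1] by (auto simp: cj1 K)
      \<comment> \<open>A preimage is the conjugate by the inverse of \<open>x 1\<close>, which
        stays in the normal subgroup \<open>F\<close>.\<close>
      show "F \<subseteq> conj_by (x 1) ` F"
      proof
        fix f assume f: "f \<in> F"
        then have "f = conj_by (x 1) (C.conj_pow (- 1) f)" "C.conj_pow (- 1) f \<in> F"
          using C.conj_pow_conj_pow[of f 1 "- 1"] C.conj_pow_in_K[of f "- 1"] C.K.subset by (auto simp: cj1 K subset_iff)
        then show "f \<in> conj_by (x 1) ` F" by blast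
      qed
    qed
  qed
  then have "homology_action F h (C.cl f) = C.cl (C.conj_pow 1 f)" if "f \<in> C.K" for f
    using homology_action_hclass[OF F \<open>countable F\<close>] that x1 F0.subset
    by (simp add: cl cj K subset_iff)
  note action = this
  have "adapted p F h (C.basis_family ` basis_index p g0 t)"
    unfolding adapted_def Let_def Ab[symmetric] by (intro ballI C.basis_family_adapted action)
  moreover have "inj_on family (basis_index p g0 t)"
    using C.basis_family_basis family by (simp cong: inj_on_cong)
  ultimately show ?thesis
    using C.basis_family_basis by (simp add: homology_basis_def Ab image)
qed

end
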